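(* A non-abelian group with one defining relation cannot be (isomorphic to) a subgroup of the group $PL_0(I)$; in particular, it cannot be a subgroup of R. Thompson's group $F$.
   Context: $I=[0,1]$. $PL_0(I)$ is the group, under composition, of all orientation-preserving piecewise linear continuous transformations (homeomorphisms) of $I$ onto itself having only finitely many breaks of the derivative. R. Thompson's group $F$ is the subgroup of $PL_0(I)$ consisting of the maps whose breaks of derivative occur at dyadic rational points and all of whose slopes are integer powers of $2$. A group with one defining relation is a group admitting a presentation with a single defining relator. *)

theory Defs
  imports "HOL-Analysis.Analysis" "HOL-Algebra.Coset" "HOL-Algebra.Bij"
begin

section \<open>Group presentations\<close>

text \<open>
  A letter \<open>(x, True)\<close> stands for the generator \<open>x\<close>, and \<open>(x, False)\<close> for its formal inverse.
  The elements of the free group are the reduced words.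
\<close>

type_synonym 'a word = "('a \<times> bool) list"

definition letter_inv :: "'a \<times> bool \<Rightarrow> 'a \<times> bool" where
  "letter_inv p = (fst p, \<not> snd p)"

fun cons_reduce :: "'a \<times> bool \<Rightarrow> 'a word \<Rightarrow> 'a word" where
  "cons_reduce p [] = [p]"
| "cons_reduce p (q # w) = (if q = letter_inv p then w else p # q # w)"

definition reduce :: "'a word \<Rightarrow> 'a word" where
  "reduce w = foldr cons_reduce w []"

fun reduced :: "'a word \<Rightarrow> bool" where
  "reduced (p # q # w) \<longleftrightarrow> q \<noteq> letter_inv p \<and> reduced (q # w)"
| "reduced _ \<longleftrightarrow> True"

definition free_group :: "'a set \<Rightarrow> 'a word monoid" where
  "free_group X =
    \<lparr>carrier = {w. set w \<subseteq> X \<times> UNIV \<and> reduced w},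
     mult = (\<lambda>u v. reduce (u @ v)),
     one = []\<rparr>"

lemma letter_inv_invol [simp]: "letter_inv (letter_inv p) = p"
  by (simp add: letter_inv_def)

lemma letter_inv_neq [simp]: "letter_inv p \<noteq> p" "p \<noteq> letter_inv p"
  by (auto simp: letter_inv_def prod_eq_iff)

lemma reduced_tl: "reduced (p # w) \<Longrightarrow> reduced w"
  by (cases w) auto

lemma reduced_cons_reduce: "reduced w \<Longrightarrow> reduced (cons_reduce p w)"
  by (cases w) (auto dest: reduced_tl)

lemma reduced_foldr: "reduced w \<Longrightarrow> reduced (foldr cons_reduce u w)"
  by (induction u) (auto intro: reduced_cons_reduce)

lemma reduced_reduce: "reduced (reduce w)"
  by (simp add: reduce_def reduced_foldr)

lemma cons_reduce_reduced: "reduced (p # w) \<Longrightarrow> cons_reduce p w = p # w"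
  by (cases w) auto

lemma reduce_reduced: "reduced w \<Longrightarrow> reduce w = w"
proof (induction w)
  case (Cons p w)
  then show ?case
    using reduced_tl[of p w] cons_reduce_reduced[of p w] by (simp add: reduce_def)
qed (simp add: reduce_def)

lemma cons_reduce_cancel:
  assumes "reduced w"
  shows "cons_reduce (letter_inv p) (cons_reduce p w) = w"
proof (cases w)
  case (Cons q v)
  then show ?thesis using assms by (cases v) auto
qed simp

lemma foldr_cons_reduce:
  assumes "reduced w"
  shows "foldr cons_reduce (cons_reduce p u) w = cons_reduce p (foldr cons_reduce u w)"
proof (cases u)
  case (Cons q v)
  have "foldr cons_reduce v w = cons_reduce p (cons_reduce (letter_inv p) (foldr cons_reduce v w))"
    using cons_reduce_cancel[OF reduced_foldr[OF assms], of "letter_inv p" v] by simp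
  then show ?thesis using Cons by auto
qed simp

lemma foldr_reduce:
  "reduced w \<Longrightarrow> foldr cons_reduce (reduce u) w = foldr cons_reduce u w"
  by (induction u) (simp_all add: reduce_def foldr_cons_reduce)

lemma reduce_append: "reduce (u @ v) = foldr cons_reduce u (reduce v)"
  by (simp add: reduce_def)

lemma reduce_append_reduce: "reduce (reduce u @ v) = reduce (u @ v)" "reduce (u @ reduce v) = reduce (u @ v)"
  by (simp_all add: reduce_append foldr_reduce reduced_reduce reduce_reduced)

lemma set_cons_reduce: "set (cons_reduce p w) \<subseteq> insert p (set w)"
  by (cases w) auto

lemma set_reduce: "set (reduce w) \<subseteq> set w"
proof (induction w)
  case (Cons p w)
  then show ?case
    using set_cons_reduce[of p "reduce w"] by (auto simp: reduce_def)
qed (simp add: reduce_def)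

lemma reduce_inverse: "reduce (rev (map letter_inv w) @ w) = []"
proof (induction w)
  case (Cons p w)
  then show ?case
    using cons_reduce_cancel[OF reduced_reduce[of w], of p] by (simp add: reduce_def)
qed (simp add: reduce_def)

theorem group_free_group: "group (free_group X)"
proof (rule groupI)
  fix u v w
  assume uvw: "u \<in> carrier (free_group X)" "v \<in> carrier (free_group X)" "w \<in> carrier (free_group X)"
  show "u \<otimes>\<^bsub>free_group X\<^esub> v \<in> carrier (free_group X)"
    using uvw set_reduce[of "u @ v"] by (auto simp: free_group_def reduced_reduce)
  show "u \<otimes>\<^bsub>free_group X\<^esub> v \<otimes>\<^bsub>free_group X\<^esub> w = u \<otimes>\<^bsub>free_group X\<^esub> (v \<otimes>\<^bsub>free_group X\<^esub> w)"
    by (simp add: free_group_def reduce_append_reduce)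
next
  fix u
  assume u: "u \<in> carrier (free_group X)"
  show "\<one>\<^bsub>free_group X\<^esub> \<otimes>\<^bsub>free_group X\<^esub> u = u"
    using u by (simp add: free_group_def reduce_reduced)
  let ?v = "reduce (rev (map letter_inv u))"
  have "?v \<in> carrier (free_group X)"
    using u set_reduce[of "rev (map letter_inv u)"]
    by (fastforce simp: free_group_def reduced_reduce letter_inv_def)
  moreover have "?v \<otimes>\<^bsub>free_group X\<^esub> u = \<one>\<^bsub>free_group X\<^esub>"
    by (simp add: free_group_def reduce_append_reduce reduce_inverse)
  ultimately show "\<exists>y\<in>carrier (free_group X). y \<otimes>\<^bsub>free_group X\<^esub> u = \<one>\<^bsub>free_group X\<^esub>"
    by blast
qed (simp add: free_group_def)

definition normal_closure :: "('a, 'b) monoid_scheme \<Rightarrow> 'a set \<Rightarrow> 'a set" where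
  "normal_closure G R = \<Inter>{N. N \<lhd> G \<and> R \<subseteq> N}"

definition has_presentation :: "('g, 'b) monoid_scheme \<Rightarrow> 'a set \<Rightarrow> 'a word set \<Rightarrow> bool" where
  "has_presentation G X R \<longleftrightarrow>
     R \<subseteq> carrier (free_group X) \<and> free_group X Mod normal_closure (free_group X) R \<cong> G"


section \<open>Piecewise linear homeomorphisms of the unit interval\<close>

text \<open>
  Elements are functions extensional on \<open>{0..1}\<close>, so their values outside the interval carry no
  information. The finite set \<open>P\<close> is a subdivision: \<open>f\<close> is affine on the closure of every
  subinterval of \<open>{0..1}\<close> whose interior avoids \<open>P\<close>.
\<close>

definition piecewise_linear :: "(real \<Rightarrow> real) \<Rightarrow> bool" where
  "piecewise_linear f \<longleftrightarrow>
    (\<exists>P. finite P \<and>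
      (\<forall>a b. 0 \<le> a \<longrightarrow> a < b \<longrightarrow> b \<le> 1 \<longrightarrow> {a<..<b} \<inter> P = {} \<longrightarrow>
        (\<exists>m c. \<forall>x\<in>{a..b}. f x = m * x + c)))"

definition PL0 :: "(real \<Rightarrow> real) monoid" where
  "PL0 = BijGroup {0..1}
    \<lparr>carrier := {f \<in> Bij {0..1}. continuous_on {0..1} f \<and> strict_mono_on {0..1} f \<and> piecewise_linear f}\<rparr>"

definition breaks :: "(real \<Rightarrow> real) \<Rightarrow> real set" where
  "breaks f = {x \<in> {0<..<1}. \<not> f differentiable (at x)}"

definition dyadic_rationals :: "real set" where
  "dyadic_rationals = {of_int k / 2 ^ n |(k :: int) (n :: nat). True}"

definition Thompson_F :: "(real \<Rightarrow> real) monoid" where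
  "Thompson_F = PL0
    \<lparr>carrier := {f \<in> carrier PL0.
       breaks f \<subseteq> dyadic_rationals \<and>
       (\<forall>x \<in> {0<..<1} - breaks f. \<exists>k :: int. deriv f x = 2 powi k)}\<rparr>"

lemma Bij_unit_mem: "f \<in> Bij {0..1::real} \<Longrightarrow> x \<in> {0..1} \<Longrightarrow> f x \<in> {0..1}"
  using Bij_imp_funcset by blast

lemma piecewise_linear_compose:
  assumes f: "f \<in> carrier PL0" and g: "g \<in> carrier PL0"
  shows "piecewise_linear (compose {0..1} f g)"
proof -
  have gB: "g \<in> Bij {0..1}" and gm: "strict_mono_on {0..1} g"
    using g by (auto simp: PL0_def)
  have gim: "g ` {0..1} = {0..1}" and ginj: "inj_on g {0..1}"
    using gB by (auto simp: Bij_def bij_betw_def)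
  obtain P where P: "finite P" "\<And>a b. \<lbrakk>0 \<le> a; a < b; b \<le> 1; {a<..<b} \<inter> P = {}\<rbrakk> \<Longrightarrow>
      \<exists>m c. \<forall>x\<in>{a..b}. f x = m * x + c"
    using f unfolding PL0_def piecewise_linear_def by auto
  obtain Q where Q: "finite Q" "\<And>a b. \<lbrakk>0 \<le> a; a < b; b \<le> 1; {a<..<b} \<inter> Q = {}\<rbrakk> \<Longrightarrow>
      \<exists>m c. \<forall>x\<in>{a..b}. g x = m * x + c"
    using g unfolding PL0_def piecewise_linear_def by auto
  define S where "S = Q \<union> (g -` P \<inter> {0..1})"
  have "finite S"
    unfolding S_def using P(1) Q(1) ginj by (simp add: finite_vimage_IntI)
  moreover have "\<exists>m c. \<forall>x\<in>{a..b}. compose {0..1} f g x = m * x + c"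
    if ab: "0 \<le> a" "a < b" "b \<le> 1" "{a<..<b} \<inter> S = {}" for a b
  proof -
    have "{a<..<b} \<inter> Q = {}" using ab(4) unfolding S_def by blast
    then obtain m c where mc: "\<And>x. x \<in> {a..b} \<Longrightarrow> g x = m * x + c"
      using Q(2)[OF ab(1,2,3)] by blast
    have gab: "g a < g b" using gm ab by (auto simp: strict_mono_on_def)
    have gr: "0 \<le> g a" "g b \<le> 1"
      using Bij_unit_mem[OF gB, of a] Bij_unit_mem[OF gB, of b] ab by auto
    have "{g a<..<g b} \<inter> P = {}"
    proof (rule ccontr)
      assume "{g a<..<g b} \<inter> P \<noteq> {}"
      then obtain y where y: "g a < y" "y < g b" "y \<in> P" by auto
      then have "y \<in> g ` {0..1}" using gim gr by auto
      then obtain x where x: "x \<in> {0..1}" "y = g x" by auto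
      have "a < x" "x < b"
        using strict_mono_on_less[OF gm, of a x] strict_mono_on_less[OF gm, of x b] x y ab by auto
      then have "x \<in> {a<..<b} \<inter> S" using x y by (auto simp: S_def)
      with ab(4) show False by blast
    qed
    then obtain m' c' where mc': "\<And>x. x \<in> {g a..g b} \<Longrightarrow> f x = m' * x + c'"
      using P(2)[OF gr(1) gab gr(2)] by blast
    have "compose {0..1} f g x = (m' * m) * x + (m' * c + c')" if x: "x \<in> {a..b}" for x
    proof -
      have "g x \<in> {g a..g b}"
        using strict_mono_on_leD[OF gm, of a x] strict_mono_on_leD[OF gm, of x b] x ab by auto
      then show ?thesis
        using mc'[of "g x"] mc[OF x] x ab by (auto simp: compose_def algebra_simps)
    qed
    then show ?thesis by blast
  qed
  ultimately show ?thesis unfolding piecewise_linear_def by blast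
qed

lemma piecewise_linear_inverse:
  assumes f: "f \<in> carrier PL0"
  shows "piecewise_linear (restrict (inv_into {0..1} f) {0..1})" (is "piecewise_linear ?g")
proof -
  have fB: "f \<in> Bij {0..1}" and fm: "strict_mono_on {0..1} f"
    using f by (auto simp: PL0_def)
  have fim: "f ` {0..1} = {0..1}" and finj: "inj_on f {0..1}"
    using fB by (auto simp: Bij_def bij_betw_def)
  have g: "?g y \<in> {0..1}" "f (?g y) = y" if "y \<in> {0..1}" for y
    using that fim inv_into_into[of y f "{0..1}"] f_inv_into_f[of y f "{0..1}"] by auto
  obtain P where P: "finite P" "\<And>a b. \<lbrakk>0 \<le> a; a < b; b \<le> 1; {a<..<b} \<inter> P = {}\<rbrakk> \<Longrightarrow>
      \<exists>m c. \<forall>x\<in>{a..b}. f x = m * x + c"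
    using f unfolding PL0_def piecewise_linear_def by auto
  have "\<exists>m c. \<forall>x\<in>{a..b}. ?g x = m * x + c"
    if ab: "0 \<le> a" "a < b" "b \<le> 1" "{a<..<b} \<inter> f ` P = {}" for a b
  proof -
    define a' b' where "a' = ?g a" and "b' = ?g b"
    have a': "a' \<in> {0..1}" "f a' = a" and b': "b' \<in> {0..1}" "f b' = b"
      using g[of a] g[of b] ab unfolding a'_def b'_def by auto
    have lt: "a' < b'" using strict_mono_on_less[OF fm, of a' b'] a' b' ab by auto
    have "{a'<..<b'} \<inter> P = {}"
    proof (rule ccontr)
      assume "{a'<..<b'} \<inter> P \<noteq> {}"
      then obtain x where x: "a' < x" "x < b'" "x \<in> P" by auto
      then have "f x \<in> {a<..<b} \<inter> f ` P"
        using strict_mono_on_less[OF fm, of a' x] strict_mono_on_less[OF fm, of x b'] a' b' by auto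
      with ab(4) show False by blast
    qed
    then obtain m c where mc: "\<And>x. x \<in> {a'..b'} \<Longrightarrow> f x = m * x + c"
      using P(2)[of a' b'] a' b' lt by auto
    have "m \<noteq> 0" using mc[of a'] mc[of b'] a' b' lt ab by auto
    have "?g y = (1 / m) * y + (- c / m)" if y: "y \<in> {a..b}" for y
    proof -
      have y01: "y \<in> {0..1}" using y ab by auto
      have "?g y \<in> {a'..b'}"
        using strict_mono_on_less_eq[OF fm, of a' "?g y"] strict_mono_on_less_eq[OF fm, of "?g y" b']
          a' b' g[OF y01] y by auto
      then have "y = m * ?g y + c" using mc g(2)[OF y01] by metis
      then show ?thesis using \<open>m \<noteq> 0\<close> by (simp add: field_simps)
    qed
    then show ?thesis by blast
  qed
  with P(1) show ?thesis unfolding piecewise_linear_def by (intro exI[of _ "f ` P"]) auto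
qed

theorem subgroup_PL0: "subgroup (carrier PL0) (BijGroup {0..1})"
proof (rule group.subgroupI[OF group_BijGroup])
  show "carrier PL0 \<subseteq> carrier (BijGroup {0..1})"
    by (auto simp: PL0_def BijGroup_def)
  have "piecewise_linear (\<lambda>x\<in>{0..1}. x)"
    unfolding piecewise_linear_def
  proof (intro exI[of _ "{}"] conjI allI impI)
    fix a b :: real assume "0 \<le> a" "b \<le> 1"
    then have "\<forall>x\<in>{a..b}. (\<lambda>x\<in>{0..1}. x) x = 1 * x + 0" by auto
    then show "\<exists>m c. \<forall>x\<in>{a..b}. (\<lambda>x\<in>{0..1}. x) x = m * x + c" by blast
  qed simp
  moreover have "continuous_on {0..1} (\<lambda>x\<in>{0..1::real}. x)"
    by (rule continuous_on_eq[OF continuous_on_id]) simp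
  ultimately have "(\<lambda>x\<in>{0..1}. x) \<in> carrier PL0"
    by (simp add: PL0_def id_Bij strict_mono_on_def)
  then show "carrier PL0 \<noteq> {}" by blast
next
  fix f assume f: "f \<in> carrier PL0"
  then have fB: "f \<in> Bij {0..1}" and fm: "strict_mono_on {0..1} f" and fc: "continuous_on {0..1} f"
    by (auto simp: PL0_def)
  have fim: "f ` {0..1} = {0..1}" and finj: "inj_on f {0..1}"
    using fB by (auto simp: Bij_def bij_betw_def)
  let ?g = "restrict (inv_into {0..1} f) {0..1}"
  have "continuous_on {0..1} (inv_into {0..1} f)"
    using continuous_on_inv[OF fc, of "inv_into {0..1} f"] finj fim by simp
  then have "continuous_on {0..1} ?g" by (rule continuous_on_eq) simp
  moreover have "strict_mono_on {0..1} ?g"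
  proof (rule strict_mono_onI)
    fix r s :: real assume rs: "r \<in> {0..1}" "s \<in> {0..1}" "r < s"
    have "inv_into {0..1} f r \<in> {0..1}" "inv_into {0..1} f s \<in> {0..1}"
      "f (inv_into {0..1} f r) = r" "f (inv_into {0..1} f s) = s"
      using rs fim by (metis inv_into_into f_inv_into_f)+
    then show "?g r < ?g s"
      using strict_mono_on_less[OF fm, of "inv_into {0..1} f r" "inv_into {0..1} f s"] rs by auto
  qed
  ultimately have "?g \<in> carrier PL0"
    using piecewise_linear_inverse[OF f] restrict_inv_into_Bij[OF fB] by (simp add: PL0_def)
  then show "inv\<^bsub>BijGroup {0..1}\<^esub> f \<in> carrier PL0"
    using inv_BijGroup[OF fB] by simp
next
  fix f g assume fg: "f \<in> carrier PL0" "g \<in> carrier PL0"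
  then have B: "f \<in> Bij {0..1}" "g \<in> Bij {0..1}" by (auto simp: PL0_def)
  then have gim: "g ` {0..1} = {0..1}" by (auto simp: Bij_def bij_betw_def)
  have "continuous_on {0..1} (f \<circ> g)"
    using fg gim by (intro continuous_on_compose) (auto simp: PL0_def)
  then have "continuous_on {0..1} (compose {0..1} f g)"
    by (rule continuous_on_eq) (simp add: compose_def)
  moreover have "strict_mono_on {0..1} (compose {0..1} f g)"
    using fg Bij_unit_mem[OF B(2)]
    by (auto simp: PL0_def compose_def strict_mono_on_def)
  ultimately show "f \<otimes>\<^bsub>BijGroup {0..1}\<^esub> g \<in> carrier PL0"
    using piecewise_linear_compose[OF fg] B compose_Bij[OF B]
    by (simp add: PL0_def BijGroup_def)
qed

corollary group_PL0: "group PL0"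
  using subgroup.subgroup_is_group[OF subgroup_PL0 group_BijGroup] by (simp add: PL0_def)

end

theory Submission
  imports Defs "HOL-Library.Poly_Mapping"
begin

text \<open>
  The theorem follows from two facts that pull in opposite directions.

  On the one hand, a non-abelian group of piecewise linear homeomorphisms of the interval contains a
  free abelian group of rank three. Two maps that do not commute still commute near each of their
  common fixed points, because both are linear on either side of such a point. So their commutator is
  the identity near all common fixed points and moves points in finitely many components of the
  complement. Among the nontrivial elements with this property, take one that moves points in the
  fewest components. The group has no global fixed point within a component, so some element pushes
  the support of the chosen one off itself there, and minimality makes the resulting conjugates
  commute everywhere (\<open>commuting_triple\<close>).

  On the other hand, a one-relator group \<open>G\<close> of such maps cannot contain three independent commuting
  elements. A group of increasing maps is left-orderable; the corresponding choice of maximal values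
  shows that its integral group ring has no zero divisors (\<open>unique_products_line_aut\<close>,
  \<open>group_ring_no_zero_divisors\<close>). By Fox calculus the relation module of \<open>G\<close> is a cyclic submodule of a
  free module, generated by the derivatives of the relator (\<open>fox_normal_closure\<close>); without zero divisors it is free or zero, so that \<open>G\<close> has cohomological
  dimension at most two, whereas a free abelian group of rank three has dimension three.
  The contradiction is derived directly in \<open>one_relator_no_commuting_triple\<close>, using the exactness of the
  Koszul complex in the form \<open>pair_right_ideal_cancel\<close>.
\<close>

section \<open>Integral group rings\<close>

text \<open>
  For a group written additively, convolution makes the finitely supported integer functions into
  the integral group ring. Groups are types of class \<open>group_add\<close> (not assumed commutative), so that
  the ring structure comes from \<open>Poly_Mapping\<close>; an identity such as \<open>a + b = b + a\<close> really is a
  statement about \<open>a\<close> and \<open>b\<close>.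
\<close>

type_synonym 'g group_ring = "'g \<Rightarrow>\<^sub>0 int"

abbreviation lookup :: "('a \<Rightarrow>\<^sub>0 'b::zero) \<Rightarrow> 'a \<Rightarrow> 'b" where
  "lookup \<equiv> Poly_Mapping.lookup"

abbreviation keys :: "('a \<Rightarrow>\<^sub>0 'b::zero) \<Rightarrow> 'a set" where
  "keys \<equiv> Poly_Mapping.keys"

abbreviation group_el :: "'g \<Rightarrow> 'g group_ring" where
  "group_el g \<equiv> Poly_Mapping.single g 1"

lemma group_el_mult:
  fixes g h :: "'g::group_add"
  shows "group_el g * group_el h = group_el (g + h)"
  by (simp add: mult_single)

lemma group_el_mult_assoc:
  fixes g h :: "'g::group_add"
  shows "group_el g * (group_el h * \<alpha>) = group_el (g + h) * \<alpha>"
  by (simp add: group_el_mult flip: mult.assoc)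

lemma lookup_group_ring_mult:
  fixes \<alpha> \<beta> :: "'g::group_add group_ring"
  shows "lookup (\<alpha> * \<beta>) k = (\<Sum>l\<in>keys \<alpha>. lookup \<alpha> l * lookup \<beta> (- l + k))"
proof -
  have "lookup (\<alpha> * \<beta>) k = (\<Sum>l. lookup \<alpha> l * (\<Sum>q. lookup \<beta> q when k = l + q))"
    by (rule lookup_mult)
  also have "\<dots> = (\<Sum>l. lookup \<alpha> l * lookup \<beta> (- l + k))"
  proof (rule Sum_any.cong)
    fix l
    have "k = l + q \<longleftrightarrow> q = - l + k" for q by (metis add_minus_cancel minus_add_cancel)
    then show "lookup \<alpha> l * (\<Sum>q. lookup \<beta> q when k = l + q) = lookup \<alpha> l * lookup \<beta> (- l + k)"
      by simp
  qed
  also have "\<dots> = (\<Sum>l\<in>keys \<alpha>. lookup \<alpha> l * lookup \<beta> (- l + k))"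
    by (rule Sum_any.expand_superset) (auto simp: in_keys_iff)
  finally show ?thesis .
qed

lemma lookup_group_el_mult:
  fixes g :: "'g::group_add"
  shows "lookup (group_el g * \<beta>) k = lookup \<beta> (- g + k)"
  by (simp add: lookup_group_ring_mult)

lemma group_el_minus_one_eq_0_iff:
  fixes g :: "'g::group_add"
  shows "group_el g - 1 = 0 \<longleftrightarrow> g = 0"
proof
  assume "group_el g - 1 = 0"
  then have "group_el g = group_el 0" by simp
  then show "g = 0" by (metis lookup_single_eq lookup_single_not_eq zero_neq_one)
qed simp

text \<open>
  The usual combinatorial criterion for the absence of zero divisors: one product of the two
  supports is attained only once, so its coefficient cannot cancel.
\<close>

definition unique_products :: "'g::group_add itself \<Rightarrow> bool" where
  "unique_products _ \<longleftrightarrow> (\<forall>S T :: 'g set. finite S \<longrightarrow> finite T \<longrightarrow> S \<noteq> {} \<longrightarrow> T \<noteq> {} \<longrightarrow>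
     (\<exists>s\<in>S. \<exists>t\<in>T. \<forall>s'\<in>S. \<forall>t'\<in>T. s' + t' = s + t \<longrightarrow> s' = s \<and> t' = t))"

lemma group_ring_no_zero_divisors:
  fixes \<alpha> \<beta> :: "'g::group_add group_ring"
  assumes "unique_products TYPE('g)" and "\<alpha> * \<beta> = 0"
  shows "\<alpha> = 0 \<or> \<beta> = 0"
proof (rule ccontr)
  assume "\<not> ?thesis"
  then have "keys \<alpha> \<noteq> {}" "keys \<beta> \<noteq> {}" by auto
  then obtain s t where st: "s \<in> keys \<alpha>" "t \<in> keys \<beta>"
    and uniq: "\<And>s' t'. s' \<in> keys \<alpha> \<Longrightarrow> t' \<in> keys \<beta> \<Longrightarrow> s' + t' = s + t \<Longrightarrow> s' = s \<and> t' = t"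
    using assms(1) finite_keys[of \<alpha>] finite_keys[of \<beta>] unfolding unique_products_def by metis
  have "lookup (\<alpha> * \<beta>) (s + t) = (\<Sum>l\<in>keys \<alpha>. if l = s then lookup \<alpha> s * lookup \<beta> t else 0)"
    unfolding lookup_group_ring_mult
  proof (rule sum.cong)
    fix l assume l: "l \<in> keys \<alpha>"
    show "lookup \<alpha> l * lookup \<beta> (- l + (s + t)) = (if l = s then lookup \<alpha> s * lookup \<beta> t else 0)"
    proof (cases "l = s")
      case False
      then have "- l + (s + t) \<notin> keys \<beta>"
        using uniq[OF l, of "- l + (s + t)"] by (auto simp: add_minus_cancel)
      with False show ?thesis by (simp add: in_keys_iff)
    qed (simp add: minus_add_cancel)
  qed simp
  then have "lookup (\<alpha> * \<beta>) (s + t) = lookup \<alpha> s * lookup \<beta> t"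
    using st by simp
  with st assms(2) show False by (simp add: in_keys_iff)
qed

text \<open>
  Cutting the support down to a set \<open>U\<close> commutes with left multiplication by every group element
  that preserves \<open>U\<close>. With \<open>U\<close> a union of right cosets of a subgroup \<open>B\<close>, this replaces any
  description of the group ring as a free module over the group ring of \<open>B\<close>.
\<close>

definition restrict_support :: "'g set \<Rightarrow> 'g group_ring \<Rightarrow> 'g group_ring" where
  "restrict_support U \<alpha> = Poly_Mapping.mapp (\<lambda>k n. if k \<in> U then n else 0) \<alpha>"

lemma lookup_restrict_support:
  "lookup (restrict_support U \<alpha>) k = (if k \<in> U then lookup \<alpha> k else 0)"
  by (simp add: restrict_support_def lookup_mapp when_def in_keys_iff)

lemma restrict_support_add:
  "restrict_support U (\<alpha> + \<beta>) = restrict_support U \<alpha> + restrict_support U \<beta>"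
  by (rule poly_mapping_eqI) (simp add: lookup_restrict_support lookup_add)

lemma restrict_support_diff:
  "restrict_support U (\<alpha> - \<beta>) = restrict_support U \<alpha> - restrict_support U \<beta>"
  by (rule poly_mapping_eqI) (simp add: lookup_restrict_support lookup_minus)

lemma restrict_support_group_el_mult:
  fixes g :: "'g::group_add"
  assumes "\<And>k. - g + k \<in> U \<longleftrightarrow> k \<in> U"
  shows "restrict_support U (group_el g * \<alpha>) = group_el g * restrict_support U \<alpha>"
  by (rule poly_mapping_eqI) (simp add: lookup_restrict_support lookup_group_el_mult assms)

definition pair_right_ideal :: "'g::group_add \<Rightarrow> 'g \<Rightarrow> 'g group_ring set" where
  "pair_right_ideal a b = {(group_el a - 1) * p + (group_el b - 1) * q | p q. True}"

lemma pair_right_idealI: "(group_el a - 1) * p + (group_el b - 1) * q \<in> pair_right_ideal a b"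
  by (auto simp: pair_right_ideal_def)

lemma pair_right_ideal_add:
  assumes "\<alpha> \<in> pair_right_ideal a b" "\<beta> \<in> pair_right_ideal a b"
  shows "\<alpha> + \<beta> \<in> pair_right_ideal a b"
proof -
  obtain p q p' q' where eq: "\<alpha> = (group_el a - 1) * p + (group_el b - 1) * q"
    "\<beta> = (group_el a - 1) * p' + (group_el b - 1) * q'"
    using assms by (auto simp: pair_right_ideal_def)
  have "\<alpha> + \<beta> = (group_el a - 1) * (p + p') + (group_el b - 1) * (q + q')"
    unfolding eq by (simp add: algebra_simps)
  then show ?thesis by (metis pair_right_idealI)
qed

lemma pair_right_ideal_uminus:
  assumes "\<alpha> \<in> pair_right_ideal a b"
  shows "- \<alpha> \<in> pair_right_ideal a b"
proof -
  obtain p q where eq: "\<alpha> = (group_el a - 1) * p + (group_el b - 1) * q"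
    using assms by (auto simp: pair_right_ideal_def)
  have "- \<alpha> = (group_el a - 1) * (- p) + (group_el b - 1) * (- q)"
    unfolding eq by (simp add: algebra_simps)
  then show ?thesis by (metis pair_right_idealI)
qed

lemma pair_right_ideal_commuting_mult:
  assumes "c + a = a + c" "c + b = b + c" "\<alpha> \<in> pair_right_ideal a b"
  shows "group_el c * \<alpha> \<in> pair_right_ideal a b"
proof -
  obtain p q where eq: "\<alpha> = (group_el a - 1) * p + (group_el b - 1) * q"
    using assms(3) by (auto simp: pair_right_ideal_def)
  have "group_el c * \<alpha> = (group_el a - 1) * (group_el c * p) + (group_el b - 1) * (group_el c * q)"
    unfolding eq using assms(1,2) by (simp add: algebra_simps group_el_mult_assoc)
  then show ?thesis by (metis pair_right_idealI)
qed

lemma pair_right_ideal_restrict_support: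
  assumes U: "\<And>k. - a + k \<in> U \<longleftrightarrow> k \<in> U" "\<And>k. - b + k \<in> U \<longleftrightarrow> k \<in> U"
    and "\<alpha> \<in> pair_right_ideal a b"
  shows "restrict_support U \<alpha> \<in> pair_right_ideal a b"
proof -
  obtain p q where eq: "\<alpha> = (group_el a - 1) * p + (group_el b - 1) * q"
    using assms(3) by (auto simp: pair_right_ideal_def)
  have "restrict_support U \<alpha> = (group_el a - 1) * restrict_support U p + (group_el b - 1) * restrict_support U q"
    unfolding eq by (simp add: algebra_simps restrict_support_add restrict_support_diff
        restrict_support_group_el_mult[OF U(1)] restrict_support_group_el_mult[OF U(2)])
  then show ?thesis by (metis pair_right_idealI)
qed

primrec npow :: "nat \<Rightarrow> 'g::group_add \<Rightarrow> 'g" where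
  "npow 0 c = 0"
| "npow (Suc n) c = c + npow n c"

lemma npow_add: "npow (m + n) c = npow m c + npow n c"
  by (induction m) (simp_all add: add.assoc)

definition is_subgroup :: "'g::group_add set \<Rightarrow> bool" where
  "is_subgroup B \<longleftrightarrow> 0 \<in> B \<and> (\<forall>x\<in>B. \<forall>y\<in>B. x - y \<in> B)"

lemma is_subgroup_closed:
  assumes "is_subgroup B"
  shows "0 \<in> B" "x \<in> B \<Longrightarrow> y \<in> B \<Longrightarrow> x - y \<in> B" "x \<in> B \<Longrightarrow> - x \<in> B"
    "x \<in> B \<Longrightarrow> y \<in> B \<Longrightarrow> x + y \<in> B"
proof -
  show 0: "0 \<in> B" and d: "\<And>x y. x \<in> B \<Longrightarrow> y \<in> B \<Longrightarrow> x - y \<in> B"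
    using assms by (auto simp: is_subgroup_def)
  show m: "\<And>x. x \<in> B \<Longrightarrow> - x \<in> B" using d[OF 0] by simp
  show "x \<in> B \<Longrightarrow> y \<in> B \<Longrightarrow> x + y \<in> B" using d[OF _ m] by fastforce
qed

text \<open>
  Modulo the right ideal generated by \<open>a - 1\<close> and \<open>b - 1\<close>, the element \<open>c - 1\<close> is not a zero divisor:
  this is the exactness of the Koszul complex of a commuting triple. The hypothesis says that
  \<open>c \<cdot> \<alpha>\<close> and \<open>\<alpha>\<close> agree modulo the ideal, hence so do \<open>c\<^sup>n \<cdot> \<alpha>\<close> and \<open>\<alpha>\<close> for every \<open>n\<close>. As no positive power of
  \<open>c\<close> lies in \<open>B\<close>, for some \<open>n\<close> the support of \<open>c\<^sup>n \<cdot> \<alpha>\<close> misses all \<open>B\<close>-cosets that meet the support of \<open>\<alpha>\<close>.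
  Restricting the difference to these cosets leaves only \<open>- \<alpha>\<close>, which therefore lies in the ideal.
\<close>

lemma pair_right_ideal_cancel:
  fixes a b c :: "'g::group_add"
  assumes B: "is_subgroup B" "a \<in> B" "b \<in> B"
    and comm: "c + a = a + c" "c + b = b + c"
    and c: "\<And>n. n > 0 \<Longrightarrow> npow n c \<notin> B"
    and mem: "(group_el c - 1) * \<alpha> \<in> pair_right_ideal a b"
  shows "\<alpha> \<in> pair_right_ideal a b"
proof -
  note Bc = is_subgroup_closed[OF B(1)]
  define U where "U = {x + k | x k. x \<in> B \<and> k \<in> keys \<alpha>}"
  have Uinv: "- g + k \<in> U \<longleftrightarrow> k \<in> U" if "g \<in> B" for g k
  proof -
    have "h + k \<in> U" if hk: "h \<in> B" "k \<in> U" for h k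
    proof -
      obtain x k' where "k = x + k'" "x \<in> B" "k' \<in> keys \<alpha>" using hk(2) unfolding U_def by blast
      then have "h + k = (h + x) + k'" "h + x \<in> B" using Bc(4) hk(1) by (auto simp: add.assoc)
      with \<open>k' \<in> keys \<alpha>\<close> show ?thesis unfolding U_def by blast
    qed
    from this[of "-g" k] this[of g "- g + k"] show ?thesis
      using that Bc(3) by (auto simp: add_minus_cancel)
  qed
  have ideal: "group_el (npow n c) * \<alpha> - \<alpha> \<in> pair_right_ideal a b" for n
  proof (induction n)
    case 0
    then show ?case using pair_right_idealI[of a 0 b 0] by simp
  next
    case (Suc n)
    have "group_el (npow (Suc n) c) * \<alpha> - \<alpha> =
        group_el c * (group_el (npow n c) * \<alpha> - \<alpha>) + (group_el c - 1) * \<alpha>"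
      by (simp add: algebra_simps group_el_mult_assoc)
    then show ?case
      using pair_right_ideal_add[OF pair_right_ideal_commuting_mult[OF comm Suc] mem] by simp
  qed
  \<comment> \<open>For each pair of points of the support, at most one exponent is bad.\<close>
  define bad where "bad = {n. \<exists>k\<in>keys \<alpha>. npow n c + k \<in> U}"
  have "finite bad"
  proof -
    have "bad = (\<Union>k\<in>keys \<alpha>. \<Union>k'\<in>keys \<alpha>. {n. \<exists>x\<in>B. npow n c + k = x + k'})"
      unfolding bad_def U_def by auto
    moreover have "finite {n. \<exists>x\<in>B. npow n c + k = x + k'}" for k k'
    proof -
      have lt: False if "\<exists>x\<in>B. npow n c + k = x + k'" "\<exists>x\<in>B. npow (n + d) c + k = x + k'" "d > 0" for n d
      proof -
        from that obtain x x' where x: "x \<in> B" "x' \<in> B"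
          "npow n c + k = x + k'" "npow (n + d) c + k = x' + k'" by blast
        have "npow d c + (x + k') = x' + k'"
          by (metis x(3,4) npow_add add.assoc add.commute)
        then have "(npow d c + x) + k' = x' + k'" by (simp add: add.assoc)
        then have "npow d c = x' - x" by (simp add: eq_diff_eq)
        with Bc(2)[OF x(2,1)] c[OF that(3)] show False by simp
      qed
      let ?N = "{n. \<exists>x\<in>B. npow n c + k = x + k'}"
      have "m = n" if "m \<in> ?N" "n \<in> ?N" for m n
        using that lt[of m "n - m"] lt[of n "m - n"] by (cases m n rule: linorder_cases) auto
      then have "?N = {} \<or> (\<exists>m. ?N = {m})" by blast
      then show ?thesis by (elim disjE exE) simp_all
    qed
    ultimately show ?thesis by simp
  qed
  then obtain n where n: "n \<notin> bad" using ex_new_if_finite infinite_UNIV_nat by blast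
  have "restrict_support U (group_el (npow n c) * \<alpha>) = 0"
  proof (rule poly_mapping_eqI)
    fix k
    show "lookup (restrict_support U (group_el (npow n c) * \<alpha>)) k = lookup 0 k"
    proof (cases "k \<in> U")
      case True
      have "- npow n c + k \<notin> keys \<alpha>"
      proof
        assume "- npow n c + k \<in> keys \<alpha>"
        moreover have "npow n c + (- npow n c + k) \<in> U" using True by (simp add: add_minus_cancel)
        ultimately show False using n unfolding bad_def by blast
      qed
      then show ?thesis by (simp add: lookup_restrict_support lookup_group_el_mult in_keys_iff)
    qed (simp add: lookup_restrict_support)
  qed
  moreover have "restrict_support U \<alpha> = \<alpha>"
  proof (rule poly_mapping_eqI)
    fix k
    have "k \<in> keys \<alpha> \<Longrightarrow> k \<in> U" unfolding U_def using Bc(1) by force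
    then show "lookup (restrict_support U \<alpha>) k = lookup \<alpha> k"
      by (auto simp: lookup_restrict_support in_keys_iff)
  qed
  ultimately have "restrict_support U (group_el (npow n c) * \<alpha> - \<alpha>) = - \<alpha>"
    by (simp add: restrict_support_diff)
  moreover have "restrict_support U (group_el (npow n c) * \<alpha> - \<alpha>) \<in> pair_right_ideal a b"
    using Uinv[OF B(2)] Uinv[OF B(3)] ideal by (intro pair_right_ideal_restrict_support)
  ultimately show ?thesis using pair_right_ideal_uminus by fastforce
qed

text \<open>
  The ring homomorphism to the integers that sends every group element to 1. Being additive and
  invariant under right translation, it vanishes on every \<open>e \<cdot> (g - 1)\<close>.
\<close>

definition augmentation :: "'g group_ring \<Rightarrow> int" where
  "augmentation \<alpha> = (\<Sum>k\<in>keys \<alpha>. lookup \<alpha> k)"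

lemma augmentation_superset:
  "finite K \<Longrightarrow> keys \<alpha> \<subseteq> K \<Longrightarrow> augmentation \<alpha> = (\<Sum>k\<in>K. lookup \<alpha> k)"
  unfolding augmentation_def by (rule sum.mono_neutral_left) (auto simp: in_keys_iff)

lemma augmentation_add: "augmentation (\<alpha> + \<beta>) = augmentation \<alpha> + augmentation \<beta>"
  using augmentation_superset[of "keys \<alpha> \<union> keys \<beta>"] keys_add[of \<alpha> \<beta>]
  by (simp add: lookup_add sum.distrib)

lemma augmentation_diff: "augmentation (\<alpha> - \<beta>) = augmentation \<alpha> - augmentation \<beta>"
  using augmentation_add[of "\<alpha> - \<beta>" \<beta>] by simp

lemma augmentation_sum: "augmentation (sum f A) = (\<Sum>x\<in>A. augmentation (f x))"
  by (induction A rule: infinite_finite_induct) (simp_all add: augmentation_add, simp_all add: augmentation_def)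

lemma augmentation_mult_group_el:
  fixes g :: "'g::group_add"
  shows "augmentation (\<alpha> * group_el g) = augmentation \<alpha>"
proof (induction \<alpha> rule: update_induct)
  case (update \<alpha> a n)
  have "Poly_Mapping.update a n \<alpha> = \<alpha> + Poly_Mapping.single a n"
    using update(1) by (intro poly_mapping_eqI) (auto simp: lookup_update lookup_add lookup_single in_keys_iff when_def)
  moreover have "augmentation (Poly_Mapping.single h n) = n" for h :: 'g
    using update(2) by (simp add: augmentation_def)
  ultimately show ?case
    using update(3) by (simp add: augmentation_add distrib_right mult_single)
qed (simp add: augmentation_def)

lemma augmentation_one: "augmentation (1 :: 'g::group_add group_ring) = 1"
  by (simp add: augmentation_def)

section \<open>Fox calculus and one-relator groups\<close>

fun letter_val :: "('a \<Rightarrow> 'g::group_add) \<Rightarrow> 'a \<times> bool \<Rightarrow> 'g" where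
  "letter_val v (x, True) = v x"
| "letter_val v (x, False) = - v x"

definition word_val :: "('a \<Rightarrow> 'g::group_add) \<Rightarrow> 'a word \<Rightarrow> 'g" where
  "word_val v w = sum_list (map (letter_val v) w)"

lemma letter_val_inv: "letter_val v (letter_inv p) = - letter_val v p"
  by (induction v p rule: letter_val.induct) (simp_all add: letter_inv_def)

lemma word_val_simps [simp]:
  "word_val v [] = 0"
  "word_val v (p # w) = letter_val v p + word_val v w"
  "word_val v (u @ w) = word_val v u + word_val v w"
  by (simp_all add: word_val_def)

lemma word_val_reduce [simp]: "word_val v (reduce w) = word_val v w"
proof (induction w)
  case (Cons p w)
  have "word_val v (cons_reduce p u) = letter_val v p + word_val v u" for u
    by (cases u) (simp_all add: letter_val_inv add_minus_cancel)
  with Cons show ?case by (simp add: reduce_def)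
qed (simp add: reduce_def)

abbreviation inv_word :: "'a word \<Rightarrow> 'a word" where
  "inv_word w \<equiv> rev (map letter_inv w)"

lemma word_val_inv_word [simp]: "word_val v (inv_word w) = - word_val v w"
proof -
  have "word_val v (inv_word w) + word_val v w = 0"
    using arg_cong[OF reduce_inverse[of w], of "word_val v"] by simp
  then show ?thesis by (simp add: eq_neg_iff_add_eq_0)
qed

text \<open>
  Fox derivatives, with values pushed forward along \<open>v\<close> to the group ring of the target: \<open>fox v w x\<close>
  is the coefficient of the generator \<open>x\<close> when the crossed homomorphism \<open>w \<mapsto> w - 1\<close> is lifted to
  the free module on the generators. The lift property is the fundamental formula below.
\<close>

fun fox_letter :: "('a \<Rightarrow> 'g::group_add) \<Rightarrow> 'a \<times> bool \<Rightarrow> 'a \<Rightarrow> 'g group_ring" where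
  "fox_letter v (y, True) x = (if y = x then 1 else 0)"
| "fox_letter v (y, False) x = (if y = x then - group_el (- v y) else 0)"

fun fox :: "('a \<Rightarrow> 'g::group_add) \<Rightarrow> 'a word \<Rightarrow> 'a \<Rightarrow> 'g group_ring" where
  "fox v [] x = 0"
| "fox v (p # w) x = fox_letter v p x + group_el (letter_val v p) * fox v w x"

lemma fox_append: "fox v (u @ w) x = fox v u x + group_el (word_val v u) * fox v w x"
  by (induction u) (simp_all add: algebra_simps group_el_mult_assoc)

lemma fox_letter_inv: "fox_letter v (letter_inv p) x = - group_el (- letter_val v p) * fox_letter v p x"
  by (induction v p x rule: fox_letter.induct) (auto simp: letter_inv_def group_el_mult)

lemma fox_reduce: "fox v (reduce w) x = fox v w x"
proof (induction w)
  case (Cons p w)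
  have "fox v (cons_reduce p u) x = fox_letter v p x + group_el (letter_val v p) * fox v u x" for u
    by (cases u) (auto simp: letter_val_inv fox_letter_inv algebra_simps group_el_mult_assoc)
  with Cons show ?case by (simp add: reduce_def)
qed (simp add: reduce_def)

lemma fox_inv_word: "fox v (inv_word w) x = - group_el (- word_val v w) * fox v w x"
proof -
  have "fox v (inv_word w) x + group_el (- word_val v w) * fox v w x = 0"
    using fox_reduce[of v "inv_word w @ w" x] reduce_inverse[of w] by (simp add: fox_append)
  then show ?thesis by (simp add: eq_neg_iff_add_eq_0)
qed

lemma fox_fundamental:
  assumes "finite S" "fst ` set w \<subseteq> S"
  shows "(\<Sum>x\<in>S. fox v w x * (group_el (v x) - 1)) = group_el (word_val v w) - 1"
  using assms(2)
proof (induction w)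
  case (Cons p w)
  have p: "(\<Sum>x\<in>S. fox_letter v p x * (group_el (v x) - 1)) = group_el (letter_val v p) - 1"
  proof (cases "(v, p)" rule: letter_val.cases)
    case (1 _ y)
    then have "(\<Sum>x\<in>S. fox_letter v p x * (group_el (v x) - 1)) =
       (\<Sum>x\<in>S. if y = x then group_el (v y) - 1 else 0)"
      by (intro sum.cong) auto
    then show ?thesis using 1 Cons.prems assms(1) by simp
  next
    case (2 _ y)
    then have "(\<Sum>x\<in>S. fox_letter v p x * (group_el (v x) - 1)) =
       (\<Sum>x\<in>S. if y = x then group_el (- v y) - 1 else 0)"
      by (intro sum.cong) (auto simp: algebra_simps group_el_mult)
    then show ?thesis using 2 Cons.prems assms(1) by simp
  qed
  have "(\<Sum>x\<in>S. fox v (p # w) x * (group_el (v x) - 1)) =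
      (\<Sum>x\<in>S. fox_letter v p x * (group_el (v x) - 1)) +
      group_el (letter_val v p) * (\<Sum>x\<in>S. fox v w x * (group_el (v x) - 1))"
    by (simp only: fox.simps distrib_right sum.distrib sum_distrib_left mult.assoc)
  also have "\<dots> = (group_el (letter_val v p) - 1) + group_el (letter_val v p) * (group_el (word_val v w) - 1)"
    using p Cons by simp
  also have "\<dots> = group_el (word_val v (p # w)) - 1"
    by (simp add: algebra_simps group_el_mult)
  finally show ?case .
qed simp

lemma carrier_free_group: "w \<in> carrier (free_group X) \<longleftrightarrow> set w \<subseteq> X \<times> UNIV \<and> reduced w"
  by (auto simp: free_group_def)

lemma free_group_mult [simp]: "u \<otimes>\<^bsub>free_group X\<^esub> w = reduce (u @ w)"
  by (simp add: free_group_def)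

lemma free_group_one [simp]: "\<one>\<^bsub>free_group X\<^esub> = []"
  by (simp add: free_group_def)

lemma inv_word_carrier:
  assumes "w \<in> carrier (free_group X)"
  shows "reduce (inv_word w) \<in> carrier (free_group X)"
  using assms set_reduce[of "inv_word w"]
  by (fastforce simp: carrier_free_group reduced_reduce letter_inv_def)

lemma free_group_inv:
  assumes "w \<in> carrier (free_group X)"
  shows "inv\<^bsub>free_group X\<^esub> w = reduce (inv_word w)"
  using assms inv_word_carrier[OF assms]
  by (intro group.inv_equality[OF group_free_group])
    (simp_all add: reduce_append_reduce reduce_inverse)

lemma normal_closure_least: "N \<lhd> G \<Longrightarrow> R \<subseteq> N \<Longrightarrow> normal_closure G R \<subseteq> N"
  by (auto simp: normal_closure_def)

text \<open>
  The words that \<open>v\<close> kills and whose vector of Fox derivatives is a left multiple of that of \<open>r\<close>. They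
  form a normal subgroup, which contains the normal closure of \<open>r\<close> as soon as \<open>v\<close> kills \<open>r\<close>: the
  relation module of a one-relator presentation is cyclic.
\<close>

definition relator_multiples :: "'a set \<Rightarrow> ('a \<Rightarrow> 'g::group_add) \<Rightarrow> 'a word \<Rightarrow> 'a word set" where
  "relator_multiples X v r = {w \<in> carrier (free_group X). word_val v w = 0 \<and> (\<exists>\<alpha>. \<forall>x. fox v w x = \<alpha> * fox v r x)}"

lemma relator_multiplesI:
  assumes "w \<in> carrier (free_group X)" "word_val v w = 0" "\<And>x. fox v w x = \<alpha> * fox v r x"
  shows "w \<in> relator_multiples X v r"
  using assms by (auto simp: relator_multiples_def)

lemma normal_relator_multiples: "relator_multiples X v r \<lhd> free_group X" (is "?N \<lhd> ?F")
proof -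
  interpret F: group ?F by (rule group_free_group)
  have "subgroup ?N ?F"
  proof (rule F.subgroupI)
    show "?N \<subseteq> carrier ?F" by (auto simp: relator_multiples_def)
    have "[] \<in> ?N" by (intro relator_multiplesI[where \<alpha> = 0]) (simp_all add: carrier_free_group)
    then show "?N \<noteq> {}" by auto
  next
    fix w assume w: "w \<in> ?N"
    then obtain \<alpha> where \<alpha>: "\<And>x. fox v w x = \<alpha> * fox v r x" by (auto simp: relator_multiples_def)
    have wF: "w \<in> carrier ?F" and w0: "word_val v w = 0" using w by (auto simp: relator_multiples_def)
    show "inv\<^bsub>?F\<^esub> w \<in> ?N"
      unfolding free_group_inv[OF wF]
      by (rule relator_multiplesI[where \<alpha> = "- \<alpha>"])
        (simp_all add: inv_word_carrier[OF wF] w0 fox_reduce fox_inv_word \<alpha>)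
  next
    fix u w assume u: "u \<in> ?N" and w: "w \<in> ?N"
    obtain \<alpha> \<beta> where ab: "\<And>x. fox v u x = \<alpha> * fox v r x" "\<And>x. fox v w x = \<beta> * fox v r x"
      using u w by (auto simp: relator_multiples_def)
    have F: "u \<in> carrier ?F" "w \<in> carrier ?F" and zero: "word_val v u = 0" "word_val v w = 0"
      using u w by (auto simp: relator_multiples_def)
    show "u \<otimes>\<^bsub>?F\<^esub> w \<in> ?N"
      by (rule relator_multiplesI[where \<alpha> = "\<alpha> + \<beta>"])
        (use F.m_closed[OF F] in \<open>simp_all add: zero fox_reduce fox_append ab distrib_right\<close>)
  qed
  moreover have "u \<otimes>\<^bsub>?F\<^esub> w \<otimes>\<^bsub>?F\<^esub> inv\<^bsub>?F\<^esub> u \<in> ?N" if u: "u \<in> carrier ?F" and w: "w \<in> ?N" for u w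
  proof -
    obtain \<alpha> where \<alpha>: "\<And>x. fox v w x = \<alpha> * fox v r x" using w by (auto simp: relator_multiples_def)
    have wF: "w \<in> carrier ?F" and w0: "word_val v w = 0" using w by (auto simp: relator_multiples_def)
    have eq: "u \<otimes>\<^bsub>?F\<^esub> w \<otimes>\<^bsub>?F\<^esub> inv\<^bsub>?F\<^esub> u = reduce (u @ w @ inv_word u)"
      by (simp add: free_group_inv[OF u] reduce_append_reduce)
    have mem: "u \<otimes>\<^bsub>?F\<^esub> w \<otimes>\<^bsub>?F\<^esub> inv\<^bsub>?F\<^esub> u \<in> carrier ?F"
      by (intro F.m_closed F.inv_closed u wF)
    show ?thesis
      using mem unfolding eq
      by (rule relator_multiplesI[where \<alpha> = "group_el (word_val v u) * \<alpha>"])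
        (simp_all add: w0 fox_reduce fox_append fox_inv_word \<alpha> algebra_simps group_el_mult_assoc)
  qed
  ultimately show ?thesis by (simp add: F.normal_inv_iff del: free_group_mult)
qed

lemma fox_normal_closure:
  assumes "r \<in> carrier (free_group X)" "word_val v r = 0"
    and "w \<in> normal_closure (free_group X) {r}"
  shows "\<exists>\<alpha>. \<forall>x. fox v w x = \<alpha> * fox v r x"
proof -
  have "{r} \<subseteq> relator_multiples X v r"
    using assms(1,2) by (auto intro: relator_multiplesI[where \<alpha> = 1])
  then have "w \<in> relator_multiples X v r"
    using assms(3) normal_closure_least[OF normal_relator_multiples] by blast
  then show ?thesis unfolding relator_multiples_def by blast
qed

lemma fox_commutator:
  assumes "word_val v u = a" "word_val v w = b" "a + b = b + a"
  shows "fox v (u @ w @ inv_word u @ inv_word w) x =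
    (1 - group_el b) * fox v u x + (group_el a - 1) * fox v w x"
proof -
  have *: "a + b - a = b" "a + b - a - b = 0"
    using assms(3) by simp_all
  show ?thesis
    using assms(1,2) by (simp add: fox_append fox_inv_word algebra_simps group_el_mult_assoc *)
qed

lemma commutator_relator_multiple:
  assumes v: "word_val v u = a" "word_val v w = b" "a + b = b + a"
    and uw: "u \<in> carrier (free_group X)" "w \<in> carrier (free_group X)"
    and r: "r \<in> carrier (free_group X)" "word_val v r = 0"
    and ker: "\<And>w. w \<in> carrier (free_group X) \<Longrightarrow> word_val v w = 0 \<Longrightarrow> w \<in> normal_closure (free_group X) {r}"
  obtains \<alpha> where "\<And>x. \<alpha> * fox v r x = (1 - group_el b) * fox v u x + (group_el a - 1) * fox v w x"
proof -
  let ?c = "u @ w @ inv_word u @ inv_word w"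
  have "set (inv_word u) \<subseteq> X \<times> UNIV" "set (inv_word w) \<subseteq> X \<times> UNIV"
    using uw by (fastforce simp: carrier_free_group letter_inv_def)+
  then have "reduce ?c \<in> carrier (free_group X)"
    using uw order_trans[OF set_reduce[of ?c], of "X \<times> UNIV"]
    by (simp add: carrier_free_group reduced_reduce)
  moreover have "word_val v (reduce ?c) = 0"
  proof -
    have "word_val v (reduce ?c) = a + b - a - b"
      by (simp add: v(1,2) add.assoc del: add_uminus_conv_diff add: diff_conv_add_uminus)
    then show ?thesis using v(3) by simp
  qed
  ultimately obtain \<alpha> where "\<forall>x. fox v (reduce ?c) x = \<alpha> * fox v r x"
    using fox_normal_closure[OF r] ker by blast
  then show thesis using that fox_commutator[OF v] by (metis fox_reduce)
qed

text \<open>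
  A one-relator group whose group ring has no zero divisors has cohomological dimension at most
  two, so it contains no free abelian group of rank three. The following argument makes this
  explicit. The hypotheses on \<open>B\<close> and \<open>C\<close> express that \<open>a\<close>, \<open>b\<close>, \<open>c\<close> are independent.

  Write \<open>D\<close> for the vector of derivatives of \<open>r\<close>. The commutators of lifts of \<open>a\<close>, \<open>b\<close>, \<open>c\<close> have
  derivatives \<open>\<alpha> D\<close>, \<open>\<beta> D\<close>, \<open>\<gamma> D\<close>, and the Koszul relation between them, an identity of Hall-Witt type,
  gives \<open>((c - 1) \<alpha> + (a - 1) \<beta> + (b - 1) \<gamma>) D = 0\<close>. Since there are no zero divisors the bracket
  vanishes (unless \<open>D = 0\<close>, when any coefficients will do), and \<open>\<alpha> = (a - 1) p + (b - 1) q\<close> follows.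
  Comparing with the derivative of the commutator of the lifts \<open>u\<close> and \<open>w\<close> of \<open>a\<close> and \<open>b\<close>, the
  derivatives of \<open>u\<close> corrected by \<open>q D\<close> are divisible by \<open>a - 1\<close>, say with quotients \<open>e\<close>. The fundamental
  formula then turns into \<open>(a - 1) (\<Sum>x. e x (x - 1)) = a - 1\<close>. Cancelling \<open>a - 1\<close> writes 1 as an element
  of the augmentation ideal, which is absurd.
\<close>

theorem one_relator_no_commuting_triple:
  fixes v :: "'a \<Rightarrow> 'g::group_add"
  assumes unique: "unique_products TYPE('g)"
    and r: "r \<in> carrier (free_group X)" "word_val v r = 0"
    and ker: "\<And>w. w \<in> carrier (free_group X) \<Longrightarrow> word_val v w = 0 \<Longrightarrow> w \<in> normal_closure (free_group X) {r}"
    and u: "u \<in> carrier (free_group X)" "word_val v u = a"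
    and w: "w \<in> carrier (free_group X)" "word_val v w = b"
    and z: "z \<in> carrier (free_group X)" "word_val v z = c"
    and comm: "a + b = b + a" "b + c = c + b" "c + a = a + c"
    and a: "a \<noteq> 0"
    and B: "is_subgroup B" "a \<in> B" "\<And>n. n > 0 \<Longrightarrow> npow n b \<notin> B"
    and C: "is_subgroup C" "a \<in> C" "b \<in> C" "\<And>n. n > 0 \<Longrightarrow> npow n c \<notin> C"
  shows False
proof -
  note no_zero = group_ring_no_zero_divisors[OF unique]
  let ?A = "group_el a" and ?B = "group_el b" and ?C = "group_el c"
  have AB: "?B * (?A * p) = ?A * (?B * p)" and BC: "?C * (?B * p) = ?B * (?C * p)"
    and CA: "?C * (?A * p) = ?A * (?C * p)" for p
    by (simp_all add: group_el_mult_assoc comm)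
  obtain \<alpha> where \<alpha>: "\<And>x. \<alpha> * fox v r x = (1 - ?B) * fox v u x + (?A - 1) * fox v w x"
    using commutator_relator_multiple[OF u(2) w(2) comm(1) u(1) w(1) r ker] by blast
  obtain \<beta> where \<beta>: "\<And>x. \<beta> * fox v r x = (1 - ?C) * fox v w x + (?B - 1) * fox v z x"
    using commutator_relator_multiple[OF w(2) z(2) comm(2) w(1) z(1) r ker] by blast
  obtain \<gamma> where \<gamma>: "\<And>x. \<gamma> * fox v r x = (1 - ?A) * fox v z x + (?C - 1) * fox v u x"
    using commutator_relator_multiple[OF z(2) u(2) comm(3) z(1) u(1) r ker] by blast
  have syzygy: "((?C - 1) * \<alpha> + (?A - 1) * \<beta> + (?B - 1) * \<gamma>) * fox v r x = 0" for x
  proof -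
    have "((?C - 1) * \<alpha> + (?A - 1) * \<beta> + (?B - 1) * \<gamma>) * fox v r x =
      (?C - 1) * (\<alpha> * fox v r x) + (?A - 1) * (\<beta> * fox v r x) + (?B - 1) * (\<gamma> * fox v r x)"
      by (simp add: distrib_right mult.assoc)
    also have "\<dots> = 0"
      unfolding \<alpha> \<beta> \<gamma> by (simp add: algebra_simps AB BC CA)
    finally show ?thesis .
  qed
  have "\<exists>p q. \<forall>x. \<alpha> * fox v r x = ((?A - 1) * p + (?B - 1) * q) * fox v r x"
  proof (cases "\<forall>x. fox v r x = 0")
    case False
    then have "(?C - 1) * \<alpha> + (?A - 1) * \<beta> + (?B - 1) * \<gamma> = 0"
      using no_zero syzygy by blast
    then have "(?C - 1) * \<alpha> = - ((?A - 1) * \<beta> + (?B - 1) * \<gamma>)"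
      by (simp only: eq_neg_iff_add_eq_0 add.assoc)
    also have "\<dots> = (?A - 1) * (- \<beta>) + (?B - 1) * (- \<gamma>)" by simp
    finally have "(?C - 1) * \<alpha> = (?A - 1) * (- \<beta>) + (?B - 1) * (- \<gamma>)" .
    then have "(?C - 1) * \<alpha> \<in> pair_right_ideal a b" by (metis pair_right_idealI)
    then have "\<alpha> \<in> pair_right_ideal a b"
      using pair_right_ideal_cancel[OF C(1-3) comm(3) comm(2)[symmetric]] C(4) by blast
    then show ?thesis by (auto simp: pair_right_ideal_def)
  qed auto
  then obtain p q where pq: "\<And>x. \<alpha> * fox v r x = ((?A - 1) * p + (?B - 1) * q) * fox v r x" by blast
  have "\<exists>e. fox v u x + q * fox v r x = (?A - 1) * e" for x
  proof -
    have "(?B - 1) * (fox v u x + q * fox v r x) = (?A - 1) * (fox v w x - p * fox v r x)"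
      using pq[of x] \<alpha>[of x] by (simp add: algebra_simps)
    then have "(?B - 1) * (fox v u x + q * fox v r x) \<in> pair_right_ideal a 0"
      using pair_right_idealI[of a "fox v w x - p * fox v r x" 0 0] by simp
    then have "fox v u x + q * fox v r x \<in> pair_right_ideal a 0"
      using pair_right_ideal_cancel[OF B(1,2) is_subgroup_closed(1)[OF B(1)] comm(1)[symmetric]] B(3)
      by (metis add_0_left add_0_right)
    then show ?thesis by (auto simp: pair_right_ideal_def)
  qed
  then obtain e where e: "\<And>x. fox v u x + q * fox v r x = (?A - 1) * e x" by metis
  define S where "S = fst ` (set u \<union> set r)"
  have S: "finite S" "fst ` set u \<subseteq> S" "fst ` set r \<subseteq> S" by (auto simp: S_def)
  have "(?A - 1) * (\<Sum>x\<in>S. e x * (group_el (v x) - 1)) =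
      (\<Sum>x\<in>S. (fox v u x + q * fox v r x) * (group_el (v x) - 1))"
    by (simp only: e sum_distrib_left mult.assoc)
  also have "\<dots> = (\<Sum>x\<in>S. fox v u x * (group_el (v x) - 1)) + q * (\<Sum>x\<in>S. fox v r x * (group_el (v x) - 1))"
    by (simp only: distrib_right sum.distrib sum_distrib_left mult.assoc)
  also have "\<dots> = ?A - 1"
    using fox_fundamental[OF S(1,2), of v] fox_fundamental[OF S(1,3), of v] u r by simp
  finally have "(?A - 1) * ((\<Sum>x\<in>S. e x * (group_el (v x) - 1)) - 1) = 0"
    by (simp add: right_diff_distrib)
  then have "(\<Sum>x\<in>S. e x * (group_el (v x) - 1)) = 1"
    using no_zero a group_el_minus_one_eq_0_iff by fastforce
  then have "augmentation (\<Sum>x\<in>S. e x * (group_el (v x) - 1)) = 1" by (simp add: augmentation_one)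
  then show False
    by (simp add: augmentation_sum right_diff_distrib augmentation_diff augmentation_mult_group_el)
qed

section \<open>Increasing bijections of the line\<close>

text \<open>
  Increasing bijections of the real line, under composition written additively. Homeomorphisms of
  the unit interval are extended to the line by the identity; then images, preimages and
  neighbourhoods need no care at the end points.
\<close>

typedef line_aut = "{f :: real \<Rightarrow> real. strict_mono f \<and> surj f}"
  morphisms app Abs_line_aut
  by (rule exI[of _ id]) (simp add: strict_mono_def)

setup_lifting type_definition_line_aut

instantiation line_aut :: group_add
begin

lift_definition zero_line_aut :: line_aut is id
  by (simp add: strict_mono_def)

lift_definition plus_line_aut :: "line_aut \<Rightarrow> line_aut \<Rightarrow> line_aut" is "(\<circ>)"
  by (simp add: strict_mono_def comp_surj del: comp_apply) simp

lift_definition uminus_line_aut :: "line_aut \<Rightarrow> line_aut" is "inv_into UNIV"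
proof -
  fix f :: "real \<Rightarrow> real" assume f: "strict_mono f \<and> surj f"
  then have "bij f" by (auto simp: bij_def intro: strict_mono_imp_inj_on)
  then have "inv_into UNIV f (f x) = x" for x by (simp add: bij_is_inj)
  then have "strict_mono (inv_into UNIV f)" using f strict_mono_inv by blast
  then show "strict_mono (inv_into UNIV f) \<and> surj (inv_into UNIV f)"
    using \<open>bij f\<close> by (simp add: bij_is_surj bij_imp_bij_inv)
qed

definition minus_line_aut :: "line_aut \<Rightarrow> line_aut \<Rightarrow> line_aut" where
  "minus_line_aut f g = f + - g"

instance
proof
  fix f g h :: line_aut
  show "f + g + h = f + (g + h)" by transfer auto
  show "0 + f = f" by transfer auto
  show "f + 0 = f" by transfer auto
  show "- f + f = 0" by transfer (simp add: strict_mono_imp_inj_on)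
  show "f + - g = f - g" by (simp add: minus_line_aut_def)
qed

end

lemma app_add [simp]: "app (f + g) x = app f (app g x)"
  by transfer simp

lemma app_0 [simp]: "app 0 x = x"
  by transfer simp

lemma app_cancel [simp]: "app (- f) (app f x) = x" "app f (app (- f) x) = x"
  using app_add[of "- f" f x] app_add[of f "- f" x] by simp_all

lemma app_diff [simp]: "app (f - g) x = app f (app (- g) x)"
  using app_add[of f "- g" x] by simp

lemma strict_mono_app: "strict_mono (app f)"
  by transfer simp

lemma app_less_iff [simp]: "app f x < app f y \<longleftrightarrow> x < y"
  by (rule strict_mono_less[OF strict_mono_app])

lemma app_le_iff [simp]: "app f x \<le> app f y \<longleftrightarrow> x \<le> y"
  by (rule strict_mono_less_eq[OF strict_mono_app])

lemma app_eq_iff [simp]: "app f x = app f y \<longleftrightarrow> x = y"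
  by (rule strict_mono_eq[OF strict_mono_app])

lemma line_aut_eqI: "(\<And>x. app f x = app g x) \<Longrightarrow> f = g"
  by (metis app_inject ext)

lemma app_uminus_eq_iff: "app (- f) x = y \<longleftrightarrow> x = app f y"
  by (metis app_cancel)

lemma app_uminus_add [simp]: "app (- (f + g)) x = app (- g) (app (- f) x)"
  unfolding app_uminus_eq_iff by simp

lemma isCont_app: "isCont (app f) x"
proof -
  have "surj (app f)" by transfer simp
  then have "continuous_on UNIV (app f)" by (intro continuous_onI_mono) auto
  then show ?thesis by (simp add: continuous_on_eq_continuous_at)
qed

text \<open>
  Choose a point \<open>x\<close> at which two elements of \<open>T\<close> differ, keep only those \<open>t\<close> that are maximal at \<open>x\<close>,
  with value \<open>m\<close>, and keep only those \<open>s\<close> that are maximal at \<open>m\<close>. A product of the two sets takes at \<open>x\<close>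
  the largest possible value exactly if both factors have been kept, so a unique product of the
  smaller sets is also one of the original sets.
\<close>

lemma unique_products_line_aut: "unique_products TYPE(line_aut)"
proof -
  have "\<exists>s\<in>S. \<exists>t\<in>T. \<forall>s'\<in>S. \<forall>t'\<in>T. s' + t' = s + t \<longrightarrow> s' = s \<and> t' = t"
    if "finite S" "finite T" "S \<noteq> {}" "T \<noteq> {}" for S T :: "line_aut set"
    using that
  proof (induction "card T" arbitrary: S T rule: less_induct)
    case less
    show ?case
    proof (cases "\<exists>t. T = {t}")
      case True
      with less.prems(3) show ?thesis by auto
    next
      case False
      then obtain t1 t2 where "t1 \<in> T" "t2 \<in> T" "t1 \<noteq> t2" using less.prems(4) by blast
      then obtain x where x: "app t1 x \<noteq> app t2 x" using line_aut_eqI by blast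
      define m where "m = Max ((\<lambda>t. app t x) ` T)"
      define T' where "T' = {t \<in> T. app t x = m}"
      define n where "n = Max ((\<lambda>s. app s m) ` S)"
      define S' where "S' = {s \<in> S. app s m = n}"
      have m: "\<And>t. t \<in> T \<Longrightarrow> app t x \<le> m" "m \<in> (\<lambda>t. app t x) ` T"
        unfolding m_def using less.prems by (auto intro: Max_in)
      have n: "\<And>s. s \<in> S \<Longrightarrow> app s m \<le> n" "n \<in> (\<lambda>s. app s m) ` S"
        unfolding n_def using less.prems by (auto intro: Max_in)
      have "\<not> (t1 \<in> T' \<and> t2 \<in> T')" using x by (auto simp: T'_def)
      then have "T' \<subset> T" using \<open>t1 \<in> T\<close> \<open>t2 \<in> T\<close> by (auto simp: T'_def)
      then have "card T' < card T" using less.prems(2) by (rule psubset_card_mono[rotated])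
      moreover have "finite S'" "finite T'" using less.prems by (auto simp: S'_def T'_def)
      moreover have "S' \<noteq> {}" "T' \<noteq> {}" using m(2) n(2) by (auto simp: S'_def T'_def)
      ultimately obtain s t where st: "s \<in> S'" "t \<in> T'"
        and uniq: "\<And>s' t'. s' \<in> S' \<Longrightarrow> t' \<in> T' \<Longrightarrow> s' + t' = s + t \<Longrightarrow> s' = s \<and> t' = t"
        using less.hyps[of T' S'] by blast
      have "s' = s \<and> t' = t" if s': "s' \<in> S" and t': "t' \<in> T" and eq: "s' + t' = s + t" for s' t'
      proof (rule uniq[OF _ _ eq])
        have top: "app s' (app t' x) = n"
          using arg_cong[OF eq, of "\<lambda>h. app h x"] st by (simp add: S'_def T'_def)
        have "app s' (app t' x) \<le> app s' m" using m(1)[OF t'] by simp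
        then have "app s' m = n" using top n(1)[OF s'] by linarith
        then show "s' \<in> S'" using s' by (simp add: S'_def)
        have "app t' x = m" using top \<open>app s' m = n\<close> by (metis app_eq_iff)
        then show "t' \<in> T'" using t' by (simp add: T'_def)
      qed
      then show ?thesis using st by (auto simp: S'_def T'_def)
    qed
  qed
  then show ?thesis unfolding unique_products_def by blast
qed

lemma is_subgroup_stabilizer: "is_subgroup {h. app h y = y}"
  by (auto simp: is_subgroup_def) (metis app_cancel(1))

text \<open>
  An increasing map has no finite orbit except fixed points.
\<close>

lemma npow_moves:
  assumes "app b y \<noteq> y" "n > 0"
  shows "app (npow n b) y \<noteq> y"
proof -
  have up: "app (npow (Suc n) b) y > y" if "app b y > y" for n
  proof (induction n)
    case (Suc n)
    have "y < app b y" by (rule that)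
    also have "\<dots> < app b (app (npow (Suc n) b) y)" using Suc by simp
    finally show ?case by simp
  qed (use that in simp)
  have down: "app (npow (Suc n) b) y < y" if "app b y < y" for n
  proof (induction n)
    case (Suc n)
    have "app b (app (npow (Suc n) b) y) < app b y" using Suc by simp
    also have "\<dots> < y" by (rule that)
    finally show ?case by simp
  qed (use that in simp)
  obtain k where "n = Suc k" using assms(2) gr0_conv_Suc by blast
  then show ?thesis using assms(1) up[of k] down[of k] by fastforce
qed

section \<open>Commuting elements with disjoint supports\<close>

text \<open>
  Connected components of the complement of a closed set \<open>F\<close>, called gaps, are represented by their
  left end points. The inclusions \<open>{..0} \<subseteq> F\<close> and \<open>{1..} \<subseteq> F\<close> make all gaps bounded.
\<close>

definition gap_start :: "real set \<Rightarrow> real \<Rightarrow> real" where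
  "gap_start F y = Sup (F \<inter> {..y})"

lemma gap_start:
  assumes "closed F" "{..0} \<subseteq> F" "y \<notin> F"
  shows "gap_start F y \<in> F" "gap_start F y < y" "p \<in> F \<Longrightarrow> p \<le> y \<Longrightarrow> p \<le> gap_start F y"
proof -
  have ne: "F \<inter> {..y} \<noteq> {}" and bdd: "bdd_above (F \<inter> {..y})"
    using assms(2) subsetD[OF assms(2), of "min 0 y"] by (auto intro: bdd_aboveI[of _ y])
  have "gap_start F y \<in> F \<inter> {..y}"
    unfolding gap_start_def using assms(1) ne bdd by (intro closed_contains_Sup) auto
  then show "gap_start F y \<in> F" "gap_start F y < y" using assms(3) by (auto simp: less_le)
  show "p \<in> F \<Longrightarrow> p \<le> y \<Longrightarrow> p \<le> gap_start F y"
    unfolding gap_start_def using bdd by (intro cSup_upper) auto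
qed

lemma gap_end:
  fixes F :: "real set"
  assumes "closed F" "{1..} \<subseteq> F" "y \<notin> F"
  obtains u where "u \<in> F" "y < u" "\<And>p. p \<in> F \<Longrightarrow> y \<le> p \<Longrightarrow> u \<le> p"
proof -
  have ne: "F \<inter> {y..} \<noteq> {}" and bdd: "bdd_below (F \<inter> {y..})"
    using assms(2) subsetD[OF assms(2), of "max 1 y"] by (auto intro: bdd_belowI[of _ y])
  have "Inf (F \<inter> {y..}) \<in> F \<inter> {y..}"
    using assms(1) ne bdd by (intro closed_contains_Inf) auto
  moreover have "p \<in> F \<Longrightarrow> y \<le> p \<Longrightarrow> Inf (F \<inter> {y..}) \<le> p" for p
    using bdd by (intro cInf_lower) auto
  moreover from calculation(1) have "Inf (F \<inter> {y..}) \<noteq> y" using assms(3) by (metis IntD1)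
  ultimately show thesis using that[of "Inf (F \<inter> {y..})"] by (simp add: less_le)
qed

lemma gap_start_app:
  assumes "\<And>p. p \<in> F \<Longrightarrow> app k p = p"
  shows "gap_start F (app k y) = gap_start F y"
proof -
  have "p \<le> app k y \<longleftrightarrow> p \<le> y" if "p \<in> F" for p
    using app_le_iff[of k p y] assms[OF that] by simp
  then have "F \<inter> {..app k y} = F \<inter> {..y}" by auto
  then show ?thesis by (simp add: gap_start_def)
qed

text \<open>
  In a group fixing \<open>F\<close> pointwise, these elements form a normal subgroup. If \<open>F\<close> is closed and all gaps
  lie in the unit interval, each of them moves points in finitely many gaps only, so that their
  number can be minimised.
\<close>

definition trivial_near :: "real set \<Rightarrow> line_aut \<Rightarrow> bool" where
  "trivial_near F h \<longleftrightarrow> (\<forall>p\<in>F. \<exists>\<delta>>0. \<forall>x. \<bar>x - p\<bar> < \<delta> \<longrightarrow> app h x = x)"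

lemma trivial_near_fixes: "trivial_near F h \<Longrightarrow> p \<in> F \<Longrightarrow> app h p = p"
  unfolding trivial_near_def by force

lemma trivial_near_add:
  assumes "trivial_near F h" "trivial_near F k"
  shows "trivial_near F (h + k)"
  unfolding trivial_near_def
proof
  fix p assume "p \<in> F"
  then obtain d e where "d > 0" "e > 0" "\<And>x. \<bar>x - p\<bar> < d \<Longrightarrow> app h x = x" "\<And>x. \<bar>x - p\<bar> < e \<Longrightarrow> app k x = x"
    using assms unfolding trivial_near_def by metis
  then show "\<exists>\<delta>>0. \<forall>x. \<bar>x - p\<bar> < \<delta> \<longrightarrow> app (h + k) x = x"
    by (intro exI[of _ "min d e"]) auto
qed

lemma trivial_near_uminus: "trivial_near F h \<Longrightarrow> trivial_near F (- h)"
  unfolding trivial_near_def app_uminus_eq_iff by metis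

lemma trivial_near_conj:
  assumes "trivial_near F h" "\<And>p. p \<in> F \<Longrightarrow> app k p = p"
  shows "trivial_near F (k + h - k)"
  unfolding trivial_near_def
proof
  fix p assume p: "p \<in> F"
  then obtain d where d: "d > 0" "\<And>x. \<bar>x - p\<bar> < d \<Longrightarrow> app h x = x"
    using assms(1) unfolding trivial_near_def by metis
  have kp: "app (- k) p = p" using assms(2)[OF p] by (simp add: app_uminus_eq_iff)
  have "isCont (app (- k)) p" by (rule isCont_app)
  then obtain e where e: "e > 0" "\<And>x. \<bar>x - p\<bar> < e \<Longrightarrow> \<bar>app (- k) x - p\<bar> < d"
    using d(1) kp unfolding continuous_at_eps_delta dist_real_def by metis
  then show "\<exists>\<delta>>0. \<forall>x. \<bar>x - p\<bar> < \<delta> \<longrightarrow> app (k + h - k) x = x"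
    using d(2) by (intro exI[of _ e]) (simp add: add_diff_eq[symmetric] del: add_diff_eq)
qed

definition moved_gaps :: "real set \<Rightarrow> line_aut \<Rightarrow> real set" where
  "moved_gaps F h = gap_start F ` {y. app h y \<noteq> y}"

text \<open>
  Infinitely many moved gaps would accumulate at a point of \<open>F\<close>, and the gaps close to that point
  would lie in the neighbourhood on which \<open>h\<close> is the identity.
\<close>

lemma finite_moved_gaps:
  assumes F: "closed F" "{..0} \<subseteq> F" "{1..} \<subseteq> F" and h: "trivial_near F h"
  shows "finite (moved_gaps F h)"
proof (rule ccontr)
  assume inf: "infinite (moved_gaps F h)"
  have G: "l \<in> F \<and> l \<in> {0..1}" if lM: "l \<in> moved_gaps F h" for l
  proof -
    obtain y where y: "app h y \<noteq> y" "l = gap_start F y" using lM by (auto simp: moved_gaps_def)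
    have yF: "y \<notin> F" using y(1) trivial_near_fixes[OF h] by blast
    then have "y \<in> {0..1}" using F(2,3) by (metis atLeastAtMost_iff atLeast_iff atMost_iff linear subsetD)
    then show ?thesis using gap_start[OF F(1,2) yF] F(2) y(2) by fastforce
  qed
  have "moved_gaps F h \<subseteq> {0..1}" using G by blast
  then obtain p where p: "p islimpt moved_gaps F h"
    using inf compact_eq_Bolzano_Weierstrass[of "{0..1::real}"] by (meson compact_Icc)
  moreover have "moved_gaps F h \<subseteq> F" using G by blast
  ultimately have "p \<in> F" using F(1) closed_limpt islimpt_subset by blast
  then obtain d where d: "d > 0" "\<And>x. \<bar>x - p\<bar> < d \<Longrightarrow> app h x = x"
    using h unfolding trivial_near_def by metis
  \<comment> \<open>Two distinct gap starts near \<open>p\<close> enclose the whole gap that begins at the smaller one.\<close>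
  have "infinite (moved_gaps F h \<inter> ball p d)"
    using p d(1) by (auto simp: islimpt_eq_infinite_ball)
  then obtain l l' where l: "l \<in> moved_gaps F h \<inter> ball p d" "l' \<in> moved_gaps F h \<inter> ball p d" "l < l'"
    by (metis finite.emptyI finite_insert ex_new_if_finite linorder_neqE_linordered_idom
        infinite_imp_nonempty equals0I infinite_remove DiffE singletonI)
  obtain y where y: "app h y \<noteq> y" "l = gap_start F y" using l(1) by (auto simp: moved_gaps_def)
  have yF: "y \<notin> F" using y(1) trivial_near_fixes[OF h] by blast
  have "l < y" using gap_start(2)[OF F(1,2) yF] y(2) by simp
  moreover have "y < l'"
    using gap_start(3)[OF F(1,2) yF, of l'] G[of l'] l y(2) by force
  ultimately have "\<bar>y - p\<bar> < d" using l by (auto simp: dist_real_def)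
  with d(2) y(1) show False by blast
qed

text \<open>
  If the orbit of \<open>c\<close> stayed below \<open>d\<close>, its supremum would be a common fixed point inside the gap.
\<close>

lemma escape_compact:
  assumes K: "is_subgroup K" "\<And>k p. k \<in> K \<Longrightarrow> p \<in> F \<Longrightarrow> app k p = p"
    and F: "\<And>p. (\<And>k. k \<in> K \<Longrightarrow> app k p = p) \<Longrightarrow> p \<in> F"
    and u: "u \<in> F" and gap: "\<And>p. p \<in> F \<Longrightarrow> c \<le> p \<Longrightarrow> u \<le> p" and d: "c < u" "d < u"
  shows "\<exists>k\<in>K. d < app k c"
proof (rule ccontr)
  assume "\<not> ?thesis"
  then have le: "app k c \<le> d" if "k \<in> K" for k using that by (meson not_le_imp_less)
  note Kc = is_subgroup_closed[OF K(1)]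
  define Orb where "Orb = (\<lambda>k. app k c) ` K"
  define s where "s = Sup Orb"
  have bdd: "bdd_above Orb" using le unfolding Orb_def by (intro bdd_aboveI[of _ d]) auto
  have ne: "Orb \<noteq> {}" using Kc(1) by (auto simp: Orb_def)
  have up: "app k c \<le> s" if "k \<in> K" for k
    unfolding s_def using bdd that by (intro cSup_upper) (auto simp: Orb_def)
  have small: "app k s \<le> s" if k: "k \<in> K" for k
  proof (rule ccontr)
    assume "\<not> ?thesis"
    then have "app (- k) s < s" using app_less_iff[of k "app (- k) s" s] by simp
    then obtain k' where k': "k' \<in> K" "app (- k) s < app k' c"
      unfolding s_def using less_cSup_iff[OF ne bdd] by (auto simp: Orb_def)
    then have "s < app (k + k') c" using app_less_iff[of k "app (- k) s" "app k' c"] by simp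
    then show False using up[OF Kc(4)[OF k k'(1)]] by simp
  qed
  have "app k s = s" if "k \<in> K" for k
    using small[OF that] small[OF Kc(3)[OF that]] app_le_iff[of k "app (- k) s" s] by simp
  then have "s \<in> F" by (rule F)
  moreover have "c \<le> s" using up[OF Kc(1)] by simp
  ultimately have "u \<le> s" by (rule gap)
  moreover have "s \<le> d" unfolding s_def using ne le by (intro cSup_least) (auto simp: Orb_def)
  ultimately show False using d by simp
qed


text \<open>
  In the gap of \<open>y\<close>, the map \<open>h\<close> moves points between \<open>c\<close> and \<open>d\<close> only, and \<open>k\<close> pushes this part beyond
  \<open>d\<close>. So \<open>h\<close> and its conjugate by \<open>k\<close> have disjoint supports there, and their commutator is trivial on
  that gap. It moves no gap that \<open>h\<close> does not move, so by minimality it is trivial everywhere.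
\<close>

lemma commuting_displaced_conjugate:
  assumes F: "closed F" "{..0} \<subseteq> F" "{1..} \<subseteq> F"
    and fix_F: "\<And>p. p \<in> F \<Longrightarrow> app k p = p" and h: "trivial_near F h"
    and minimal: "\<And>w. trivial_near F w \<Longrightarrow> w \<in> K \<Longrightarrow> w \<noteq> 0 \<Longrightarrow> card (moved_gaps F h) \<le> card (moved_gaps F w)"
    and K: "is_subgroup K" "h \<in> K" "k \<in> K"
    and y: "app h y \<noteq> y"
    and u: "u \<in> F" "y < u"
    and supp: "\<And>x. gap_start F y < x \<Longrightarrow> x \<le> c \<Longrightarrow> app h x = x" "\<And>x. d \<le> x \<Longrightarrow> x < u \<Longrightarrow> app h x = x"
    and d: "gap_start F y < d" "d < u" "d < app k c"
  shows "h + (k + h - k) = (k + h - k) + h"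
proof (rule ccontr)
  define b where "b = k + h - k"
  note Kc = is_subgroup_closed[OF K(1)]
  assume "\<not> ?thesis"
  then have noncomm: "h + b \<noteq> b + h" by (simp add: b_def)
  define w where "w = - (b + h) + (h + b)"
  have b: "trivial_near F b" "b \<in> K"
    unfolding b_def using trivial_near_conj[OF h fix_F] K Kc(2,4) by auto
  have "trivial_near F w" "w \<in> K"
    unfolding w_def using b K Kc(3,4) h by (auto intro!: trivial_near_add trivial_near_uminus)
  moreover have "w \<noteq> 0" using noncomm by (simp add: w_def eq_neg_iff_add_eq_0[symmetric] minus_equation_iff)
  ultimately have le: "card (moved_gaps F h) \<le> card (moved_gaps F w)" by (intro minimal)
  have w_iff: "app w x = x \<longleftrightarrow> app h (app b x) = app b (app h x)" for x
    by (simp add: w_def app_uminus_eq_iff del: minus_add)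
  have fixed: "p \<in> F \<Longrightarrow> app h p = p" "p \<in> F \<Longrightarrow> app b p = p" "p \<in> F \<Longrightarrow> app w p = p" for p
    using trivial_near_fixes h b \<open>trivial_near F w\<close> by blast+
  have "moved_gaps F w \<subseteq> moved_gaps F h"
  proof
    fix l assume "l \<in> moved_gaps F w"
    then obtain z where z: "app w z \<noteq> z" "l = gap_start F z" by (auto simp: moved_gaps_def)
    have "app h z \<noteq> z \<or> app h (app b z) \<noteq> app b z" using z(1) w_iff by metis
    moreover have "gap_start F (app b z) = gap_start F z" using fixed(2) by (rule gap_start_app)
    ultimately show "l \<in> moved_gaps F h" using z(2) unfolding moved_gaps_def by (metis (mono_tags) imageI mem_Collect_eq)
  qed
  moreover have "gap_start F y \<in> moved_gaps F h" using y by (auto simp: moved_gaps_def)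
  moreover have "gap_start F y \<notin> moved_gaps F w"
  proof
    assume "gap_start F y \<in> moved_gaps F w"
    then obtain z where z: "app w z \<noteq> z" "gap_start F z = gap_start F y" by (auto simp: moved_gaps_def)
    have zF: "z \<notin> F" and yF: "y \<notin> F" using z(1) y fixed by blast+
    have lz: "gap_start F y < z" using gap_start(2)[OF F(1,2) zF] z(2) by simp
    have zu: "z < u" using gap_start(3)[OF F(1,2) zF u(1)] gap_start(2)[OF F(1,2) yF] z(2) u(2) by fastforce
    have kF: "app (- k) p = p" if "p \<in> F" for p using fix_F[OF that] by (simp add: app_uminus_eq_iff)
    have lF: "gap_start F y \<in> F" by (rule gap_start(1)[OF F(1,2) yF])
    have b_fix: "app b x = x" if "gap_start F y < x" "x \<le> d" for x
    proof -
      have "gap_start F y < app (- k) x" using app_less_iff[of "- k" "gap_start F y" x] kF[OF lF] that(1) by simp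
      moreover have "app (- k) x \<le> c" using app_le_iff[of "- k" x "app k c"] that(2) d(3) by simp
      ultimately have "app h (app (- k) x) = app (- k) x" by (rule supp(1))
      then show ?thesis by (simp add: b_def)
    qed
    have hd: "app h d = d" and bd: "app b d = d" using supp(2)[of d] b_fix[of d] d by auto
    have "app h (app b z) = app b (app h z)"
    proof (cases "z \<le> d")
      case True
      have "gap_start F y < app h z" using app_less_iff[of h "gap_start F y" z] fixed(1)[OF lF] lz by simp
      moreover have "app h z \<le> d" using app_le_iff[of h z d] hd True by simp
      ultimately show ?thesis using b_fix lz True by simp
    next
      case False
      have "d \<le> app b z" using app_le_iff[of b d z] bd False by simp
      moreover have "app b z < u" using app_less_iff[of b z u] fixed(2)[OF u(1)] zu by simp
      ultimately show ?thesis using supp(2) zu False by simp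
    qed
    with z(1) w_iff show False by blast
  qed
  ultimately have "moved_gaps F w \<subset> moved_gaps F h" by blast
  then have "card (moved_gaps F w) < card (moved_gaps F h)"
    by (intro psubset_card_mono finite_moved_gaps F h)
  with le show False by simp
qed

text \<open>
  A non-commuting pair whose members commute near each common fixed point generates independent
  commuting elements; continuing in the same way gives a restricted wreath product of two infinite
  cyclic groups. Take a nontrivial \<open>h\<close> that is the identity near the common fixed points, such as the
  commutator of the pair, and that moves the least number of gaps. Pushing its support within one
  gap repeatedly off itself by some \<open>k\<close> gives the three elements \<open>h\<close>, \<open>k + h - k\<close> and
  \<open>(k + k) + h - (k + k)\<close>. Independence is recorded by points \<open>y\<close> and \<open>z\<close> that only the later
  elements move.
\<close>

theorem commuting_triple:
  assumes K: "is_subgroup K" "f \<in> K" "g \<in> K" and noncomm: "f + g \<noteq> g + f"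
    and bounded: "\<And>x. x \<le> 0 \<or> 1 \<le> x \<Longrightarrow> app f x = x \<and> app g x = x"
    and germs: "\<And>p. app f p = p \<Longrightarrow> app g p = p \<Longrightarrow>
      \<exists>\<delta>>0. \<forall>x. \<bar>x - p\<bar> < \<delta> \<longrightarrow> app f (app g x) = app g (app f x)"
  obtains a b c y z where "a \<in> K" "b \<in> K" "c \<in> K"
    "a + b = b + a" "b + c = c + b" "c + a = a + c" "a \<noteq> 0"
    "app a y = y" "app b y \<noteq> y" "app a z = z" "app b z = z" "app c z \<noteq> z"
proof -
  define F where "F = {x. app f x = x \<and> app g x = x}"
  \<comment> \<open>Only elements that fix \<open>F\<close> pointwise preserve the gaps; the generated subgroup is contained in \<open>K'\<close>.\<close>
  define K' where "K' = {k \<in> K. \<forall>p\<in>F. app k p = p}"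
  note Kc = is_subgroup_closed[OF K(1)]
  have "continuous_on UNIV (app h)" for h by (simp add: continuous_at_imp_continuous_on isCont_app)
  then have "closed F" unfolding F_def
    by (intro closed_Collect_conj closed_Collect_eq continuous_on_id)
  moreover have "{..0} \<subseteq> F" "{1..} \<subseteq> F" using bounded by (auto simp: F_def)
  ultimately have F: "closed F" "{..0} \<subseteq> F" "{1..} \<subseteq> F" by simp_all
  have K': "is_subgroup K'" "f \<in> K'" "g \<in> K'" and K'F: "\<And>k p. k \<in> K' \<Longrightarrow> p \<in> F \<Longrightarrow> app k p = p"
  proof -
    show "is_subgroup K'" unfolding is_subgroup_def
    proof (intro conjI ballI)
      show "0 \<in> K'" using Kc(1) by (simp add: K'_def)
      fix k k' assume "k \<in> K'" "k' \<in> K'"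
      then show "k - k' \<in> K'" using Kc(2) unfolding K'_def by (auto simp: app_uminus_eq_iff) (metis app_cancel(1))
    qed
    show "f \<in> K'" "g \<in> K'" using K by (auto simp: K'_def F_def)
    show "\<And>k p. k \<in> K' \<Longrightarrow> p \<in> F \<Longrightarrow> app k p = p" by (auto simp: K'_def)
  qed
  note K'c = is_subgroup_closed[OF K'(1)]
  define N where "N = {h \<in> K'. trivial_near F h \<and> h \<noteq> 0}"
  have "- (g + f) + (f + g) \<in> N"
  proof -
    have "trivial_near F (- (g + f) + (f + g))"
      unfolding trivial_near_def
    proof
      fix p assume "p \<in> F"
      then obtain \<delta> where "\<delta> > 0" "\<And>x. \<bar>x - p\<bar> < \<delta> \<Longrightarrow> app f (app g x) = app g (app f x)"
        using germs unfolding F_def by blast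
      then show "\<exists>\<delta>>0. \<forall>x. \<bar>x - p\<bar> < \<delta> \<longrightarrow> app (- (g + f) + (f + g)) x = x"
        by (intro exI[of _ \<delta>]) (simp add: app_uminus_eq_iff del: minus_add)
    qed
    moreover have "- (g + f) + (f + g) \<noteq> 0"
      using noncomm by (metis add_minus_cancel add_0_right)
    ultimately show ?thesis using K' K'c(3,4) unfolding N_def by blast
  qed
  then obtain h where h: "h \<in> N" and min: "\<And>w. w \<in> N \<Longrightarrow> card (moved_gaps F h) \<le> card (moved_gaps F w)"
    using ex_has_least_nat[of "\<lambda>h. h \<in> N" _ "\<lambda>h. card (moved_gaps F h)"] by blast
  have hK: "h \<in> K'" and ht: "trivial_near F h" and h0: "h \<noteq> 0" using h by (auto simp: N_def)
  obtain y where y: "app h y \<noteq> y" using h0 line_aut_eqI[of h 0] by auto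
  have yF: "y \<notin> F" using y trivial_near_fixes[OF ht] by blast
  define l where "l = gap_start F y"
  have l: "l \<in> F" "l < y" "\<And>p. p \<in> F \<Longrightarrow> p \<le> y \<Longrightarrow> p \<le> l"
    unfolding l_def using gap_start[OF F(1,2) yF] by auto
  obtain u where u: "u \<in> F" "y < u" "\<And>p. p \<in> F \<Longrightarrow> y \<le> p \<Longrightarrow> u \<le> p"
    using gap_end[OF F(1,3) yF] by blast
  obtain \<delta>1 where \<delta>1: "\<delta>1 > 0" "\<And>x. \<bar>x - l\<bar> < \<delta>1 \<Longrightarrow> app h x = x"
    using ht l(1) unfolding trivial_near_def by metis
  obtain \<delta>2 where \<delta>2: "\<delta>2 > 0" "\<And>x. \<bar>x - u\<bar> < \<delta>2 \<Longrightarrow> app h x = x"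
    using ht u(1) unfolding trivial_near_def by metis
  define c d where "c = l + \<delta>1 / 2" and "d = u - \<delta>2 / 2"
  have ly: "l + \<delta>1 \<le> y" and yu: "y \<le> u - \<delta>2" using \<delta>1(2)[of y] \<delta>2(2)[of y] y l(2) u(2) by fastforce+
  have cd: "l < c" "c < y" "y < d" "d < u" using ly yu \<delta>1(1) \<delta>2(1) by (auto simp: c_def d_def)
  have supp: "\<And>x. l < x \<Longrightarrow> x \<le> c \<Longrightarrow> app h x = x" "\<And>x. d \<le> x \<Longrightarrow> x < u \<Longrightarrow> app h x = x"
    using \<delta>1 \<delta>2 by (auto simp: c_def d_def)
  have FI: "p \<in> F" if "\<And>k. k \<in> K' \<Longrightarrow> app k p = p" for p
    using that K'(2,3) by (auto simp: F_def)
  have gapc: "u \<le> p" if "p \<in> F" "c \<le> p" for p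
    using that u(3)[of p] l(3)[of p] cd by fastforce
  have "c < u" using cd by linarith
  then obtain k where k: "k \<in> K'" "d < app k c"
    using escape_compact[OF K'(1) K'F FI u(1) gapc _ cd(4)] by blast
  have comm: "h + (j + h - j) = (j + h - j) + h" if "j \<in> K'" "d < app j c" for j
  proof (rule commuting_displaced_conjugate[OF F K'F[OF that(1)] ht _ K'(1) hK that(1) y u(1,2), of c d])
    show "card (moved_gaps F h) \<le> card (moved_gaps F w)" if "trivial_near F w" "w \<in> K'" "w \<noteq> 0" for w
      using that min by (simp add: N_def)
  qed (use supp cd that l_def in auto)
  have hfix: "app h (app j y) = app j y" if "j \<in> K'" "d < app j c" for j
  proof (rule supp(2))
    show "d \<le> app j y" using that(2) app_less_iff[of j c y] cd by linarith
    show "app j y < u" using app_less_iff[of j y u] K'F[OF that(1) u(1)] u(2) by simp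
  qed
  have kk: "k + k \<in> K'" "d < app (k + k) c"
  proof -
    show "k + k \<in> K'" using k K'c(4) by blast
    have "app k c < app k (app k c)" using k(2) cd by simp
    then show "d < app (k + k) c" using k(2) by (simp del: app_less_iff)
  qed
  define b where "b = k + h - k"
  define c' where "c' = (k + k) + h - (k + k)"
  have hb: "h + b = b + h" unfolding b_def by (rule comm[OF k])
  have c'_eq: "c' = k + b - k"
    by (rule line_aut_eqI) (simp add: c'_def b_def)
  have "b + c' = k + (h + b) - k"
    by (rule line_aut_eqI) (simp add: c'_eq, simp add: b_def)
  also have "\<dots> = k + (b + h) - k" by (simp only: hb)
  also have "\<dots> = c' + b"
    by (rule line_aut_eqI) (simp add: c'_eq, simp add: b_def)
  finally have bc: "b + c' = c' + b" .
  have K'K: "K' \<subseteq> K" by (auto simp: K'_def)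
  show thesis
  proof (rule that[of h b c' "app k y" "app (k + k) y"])
    show "h \<in> K" using hK K'K by blast
    have "k + h - k \<in> K'" "k + k + h - (k + k) \<in> K'"
      by (rule K'c(2)[OF K'c(4)[OF k(1) hK] k(1)], rule K'c(2)[OF K'c(4)[OF kk(1) hK] kk(1)])
    then show "b \<in> K" "c' \<in> K" using K'K unfolding b_def c'_def by blast+
    show "h + b = b + h" by (rule hb)
    show "c' + h = h + c'" unfolding c'_def by (rule comm[OF kk, symmetric])
    show "app h (app k y) = app k y" by (rule hfix[OF k])
    show "app h (app (k + k) y) = app (k + k) y" by (rule hfix[OF kk])
    show "app b (app (k + k) y) = app (k + k) y" using hfix[OF k] by (simp add: b_def)
    show "app b (app k y) \<noteq> app k y" using y by (simp add: b_def)
    have "app c' (app (k + k) y) = app (k + k) (app h y)"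
      by (simp add: c'_def)
    then show "app c' (app (k + k) y) \<noteq> app (k + k) y" using y by simp
    show "b + c' = c' + b" by (rule bc)
    show "h \<noteq> 0" by (rule h0)
  qed
qed

section \<open>Piecewise linear homeomorphisms\<close>

lemma PL0_props:
  assumes "\<phi> \<in> carrier PL0"
  shows "\<phi> \<in> Bij {0..1}" "strict_mono_on {0..1} \<phi>" "piecewise_linear \<phi>" "\<phi> ` {0..1} = {0..1}"
    "\<phi> 0 = 0" "\<phi> 1 = 1"
proof -
  show B: "\<phi> \<in> Bij {0..1}" and m: "strict_mono_on {0..1} \<phi>" and "piecewise_linear \<phi>"
    using assms by (auto simp: PL0_def)
  show im: "\<phi> ` {0..1} = {0..1}" using B by (auto simp: Bij_def bij_betw_def)
  obtain x where x: "x \<in> {0..1}" "\<phi> x = 0" using im by (metis atLeastAtMost_iff imageE order_refl zero_le_one)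
  then have "\<phi> 0 \<le> 0" using strict_mono_on_leD[OF m, of 0 x] by auto
  moreover have "\<phi> 0 \<in> {0..1}" using im by auto
  ultimately show "\<phi> 0 = 0" by simp
  obtain x where x: "x \<in> {0..1}" "\<phi> x = 1" using im by (metis atLeastAtMost_iff imageE order_refl zero_le_one)
  then have "1 \<le> \<phi> 1" using strict_mono_on_leD[OF m, of x 1] by auto
  moreover have "\<phi> 1 \<in> {0..1}" using im by auto
  ultimately show "\<phi> 1 = 1" by simp
qed

definition extend :: "(real \<Rightarrow> real) \<Rightarrow> line_aut" where
  "extend \<phi> = Abs_line_aut (\<lambda>x. if x \<in> {0..1} then \<phi> x else x)"

lemma app_extend:
  assumes "\<phi> \<in> carrier PL0"
  shows "app (extend \<phi>) x = (if x \<in> {0..1} then \<phi> x else x)"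
proof -
  note \<phi> = PL0_props[OF assms]
  let ?f = "\<lambda>x. if x \<in> {0..1} then \<phi> x else x"
  have r: "\<phi> x \<in> {0..1}" if "x \<in> {0..1}" for x using \<phi>(4) that by blast
  have "strict_mono ?f"
  proof (rule strict_monoI)
    fix x y :: real assume "x < y"
    then show "?f x < ?f y"
      using strict_mono_onD[OF \<phi>(2), of x y] r[of x] r[of y] by auto
  qed
  moreover have "y \<in> range ?f" for y
  proof (cases "y \<in> {0..1}")
    case True
    then obtain x where "x \<in> {0..1}" "y = \<phi> x" using \<phi>(4) by blast
    then show ?thesis by (intro image_eqI[of _ _ x]) auto
  next
    case False
    then show ?thesis by (intro image_eqI[of _ _ y]) auto
  qed
  ultimately show ?thesis unfolding extend_def
    by (subst Abs_line_aut_inverse) auto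
qed

lemma extend_mult:
  assumes "\<phi> \<in> carrier PL0" "\<psi> \<in> carrier PL0" "\<phi> \<otimes>\<^bsub>PL0\<^esub> \<psi> \<in> carrier PL0"
  shows "extend (\<phi> \<otimes>\<^bsub>PL0\<^esub> \<psi>) = extend \<phi> + extend \<psi>"
proof (rule line_aut_eqI)
  fix x
  have "(\<phi> \<otimes>\<^bsub>PL0\<^esub> \<psi>) x = \<phi> (\<psi> x)" if "x \<in> {0..1}"
    using PL0_props(1)[OF assms(1)] PL0_props(1)[OF assms(2)] that
    by (simp add: PL0_def BijGroup_def compose_def)
  moreover have "\<psi> x \<in> {0..1}" if "x \<in> {0..1}" using PL0_props(4)[OF assms(2)] that by blast
  ultimately show "app (extend (\<phi> \<otimes>\<^bsub>PL0\<^esub> \<psi>)) x = app (extend \<phi> + extend \<psi>) x"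
    using assms by (simp add: app_extend del: atLeastAtMost_iff)
qed

lemma extend_inject:
  assumes "\<phi> \<in> carrier PL0" "\<psi> \<in> carrier PL0" "extend \<phi> = extend \<psi>"
  shows "\<phi> = \<psi>"
proof (rule extensionalityI[of _ "{0..1}"])
  show "\<phi> \<in> extensional {0..1}" "\<psi> \<in> extensional {0..1}"
    using PL0_props(1)[OF assms(1)] PL0_props(1)[OF assms(2)] by (auto simp: Bij_def)
  show "\<phi> x = \<psi> x" if "x \<in> {0..1}" for x
    using app_extend[OF assms(1), of x] app_extend[OF assms(2), of x] assms(3) that by simp
qed

lemma app_extend_outside:
  assumes "\<phi> \<in> carrier PL0" "x \<le> 0 \<or> 1 \<le> x"
  shows "app (extend \<phi>) x = x"
  using assms PL0_props(5,6)[OF assms(1)] by (cases "x = 0"; cases "x = 1") (auto simp: app_extend)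

text \<open>
  The sign \<open>\<sigma>\<close> selects the side, so that left and right neighbourhoods are handled together.
\<close>

lemma linear_on_one_side:
  assumes \<phi>: "\<phi> \<in> carrier PL0" and p: "app (extend \<phi>) p = p" and \<sigma>: "\<sigma> \<in> {1, -1 :: real}"
  shows "\<exists>m>0. \<exists>\<delta>>0. \<forall>t\<in>{0..\<delta>}. app (extend \<phi>) (p + \<sigma> * t) = p + \<sigma> * (m * t)"
proof -
  note props = PL0_props[OF \<phi>]
  have outside: ?thesis if "\<delta> > 0" "\<And>t. t \<in> {0..\<delta>} \<Longrightarrow> p + \<sigma> * t \<le> 0 \<or> 1 \<le> p + \<sigma> * t" for \<delta>
    using that app_extend_outside[OF \<phi>] by (intro exI[of _ 1] conjI exI[of _ \<delta>]) auto
  have inside: ?thesis if ab: "0 \<le> a" "a < b" "b \<le> 1" "{a, b} = {p, p + \<sigma> * \<delta>}" "\<delta> > 0"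
    and aff: "\<exists>m c. \<forall>x\<in>{a..b}. \<phi> x = m * x + c" for a b \<delta>
  proof -
    obtain m c where mc: "\<And>x. x \<in> {a..b} \<Longrightarrow> \<phi> x = m * x + c" using aff by blast
    have pab: "p \<in> {a..b}" using ab(2,4) by (auto simp: doubleton_eq_iff)
    have tab: "p + \<sigma> * t \<in> {a..b}" if "t \<in> {0..\<delta>}" for t
      using ab(2,4) \<sigma> that by (auto simp: doubleton_eq_iff)
    have "m * p + c = p" using mc[OF pab] p pab ab(1,3) by (simp add: app_extend[OF \<phi>])
    then have eq: "app (extend \<phi>) (p + \<sigma> * t) = p + \<sigma> * (m * t)" if "t \<in> {0..\<delta>}" for t
      using mc[OF tab[OF that]] tab[OF that] ab(1,3) by (simp add: app_extend[OF \<phi>] algebra_simps)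
    have "\<phi> a < \<phi> b" using strict_mono_onD[OF props(2), of a b] ab by auto
    then have "m * a < m * b" using mc[of a] mc[of b] ab(2) by simp
    then have "m > 0" using ab(2) by (simp add: mult_less_cancel_left)
    with eq ab(5) show ?thesis by blast
  qed
  obtain P where P: "finite P" "\<And>a b. \<lbrakk>0 \<le> a; a < b; b \<le> 1; {a<..<b} \<inter> P = {}\<rbrakk> \<Longrightarrow>
      \<exists>m c. \<forall>x\<in>{a..b}. \<phi> x = m * x + c"
    using props(3) unfolding piecewise_linear_def by auto
  obtain d where d: "d > 0" "\<And>x. x \<in> P \<Longrightarrow> x \<noteq> p \<Longrightarrow> d \<le> \<bar>p - x\<bar>"
    using finite_set_avoid[OF P(1), of p] by (auto simp: dist_real_def)
  consider "\<sigma> = 1" "p < 0" | "\<sigma> = 1" "0 \<le> p" "p < 1" | "\<sigma> = 1" "1 \<le> p"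
    | "\<sigma> = -1" "p \<le> 0" | "\<sigma> = -1" "0 < p" "p \<le> 1" | "\<sigma> = -1" "1 < p"
    using \<sigma> by fastforce
  then show ?thesis
  proof cases
    case 1 then show ?thesis by (intro outside[of "- p"]) auto
  next
    case 2
    define \<delta> where "\<delta> = min d (1 - p)"
    have \<delta>: "\<delta> > 0" "\<delta> \<le> d" "p + \<delta> \<le> 1" using 2 d(1) by (auto simp: \<delta>_def)
    have "{p<..<p + \<delta>} \<inter> P = {}" using d(2) \<delta>(2) by fastforce
    then show ?thesis using 2 \<delta> by (intro inside[of p "p + \<delta>" \<delta>] P(2)) auto
  next
    case 3 then show ?thesis by (intro outside[of 1]) auto
  next
    case 4 then show ?thesis by (intro outside[of 1]) auto
  next
    case 5
    define \<delta> where "\<delta> = min d p"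
    have \<delta>: "\<delta> > 0" "\<delta> \<le> d" "0 \<le> p - \<delta>" using 5 d(1) by (auto simp: \<delta>_def)
    have "{p - \<delta><..<p} \<inter> P = {}" using d(2) \<delta>(2) by fastforce
    then show ?thesis using 5 \<delta> by (intro inside[of "p - \<delta>" p \<delta>] P(2)) auto
  next
    case 6 then show ?thesis by (intro outside[of "p - 1"]) auto
  qed
qed

text \<open>
  This is where piecewise linearity enters: on either side of a common fixed point both maps are
  linear with centre \<open>p\<close>, and such maps commute.
\<close>

lemma commute_near_common_fixed_point:
  assumes \<phi>: "\<phi> \<in> carrier PL0" "app (extend \<phi>) p = p" and \<psi>: "\<psi> \<in> carrier PL0" "app (extend \<psi>) p = p"
  shows "\<exists>\<delta>>0. \<forall>x. \<bar>x - p\<bar> < \<delta> \<longrightarrow>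
    app (extend \<phi>) (app (extend \<psi>) x) = app (extend \<psi>) (app (extend \<phi>) x)"
proof -
  have side: "\<exists>\<delta>>0. \<forall>t\<in>{0..\<delta>}. app (extend \<phi>) (app (extend \<psi>) (p + \<sigma> * t)) =
      app (extend \<psi>) (app (extend \<phi>) (p + \<sigma> * t))" if \<sigma>: "\<sigma> \<in> {1, -1}" for \<sigma> :: real
  proof -
    obtain m d where m: "m > 0" "d > 0" "\<And>t. t \<in> {0..d} \<Longrightarrow> app (extend \<phi>) (p + \<sigma> * t) = p + \<sigma> * (m * t)"
      using linear_on_one_side[OF \<phi> \<sigma>] by blast
    obtain n e where n: "n > 0" "e > 0" "\<And>t. t \<in> {0..e} \<Longrightarrow> app (extend \<psi>) (p + \<sigma> * t) = p + \<sigma> * (n * t)"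
      using linear_on_one_side[OF \<psi> \<sigma>] by blast
    \<comment> \<open>Small enough that \<open>t\<close>, \<open>m * t\<close> and \<open>n * t\<close> all stay in the range where both formulas hold.\<close>
    define \<delta> where "\<delta> = min d e / (1 + m + n)"
    have "\<delta> > 0" using m n by (simp add: \<delta>_def)
    moreover have "app (extend \<phi>) (app (extend \<psi>) (p + \<sigma> * t)) = app (extend \<psi>) (app (extend \<phi>) (p + \<sigma> * t))"
      if t: "t \<in> {0..\<delta>}" for t
    proof -
      have "(1 + m + n) * t \<le> min d e"
        using t m(1) n(1) by (simp add: \<delta>_def pos_le_divide_eq mult.commute)
      then have "t + m * t + n * t \<le> d" "t + m * t + n * t \<le> e" by (simp_all add: distrib_right)
      moreover have "0 \<le> t" "0 \<le> m * t" "0 \<le> n * t" using t m(1) n(1) by auto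
      ultimately have "t \<in> {0..d}" "t \<in> {0..e}" "n * t \<in> {0..d}" "m * t \<in> {0..e}" by auto
      then show ?thesis using m(3) n(3) by (simp add: mult.left_commute)
    qed
    ultimately show ?thesis by blast
  qed
  obtain d where d: "d > 0" "\<And>t. t \<in> {0..d} \<Longrightarrow> app (extend \<phi>) (app (extend \<psi>) (p + t)) = app (extend \<psi>) (app (extend \<phi>) (p + t))"
    using side[of 1] by auto
  obtain e where e: "e > 0" "\<And>t. t \<in> {0..e} \<Longrightarrow> app (extend \<phi>) (app (extend \<psi>) (p - t)) = app (extend \<psi>) (app (extend \<phi>) (p - t))"
    using side[of "-1"] by auto
  have "app (extend \<phi>) (app (extend \<psi>) x) = app (extend \<psi>) (app (extend \<phi>) x)" if "\<bar>x - p\<bar> < min d e" for x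
    using that d(2)[of "x - p"] e(2)[of "p - x"] by (cases "p \<le> x") auto
  then show ?thesis using d(1) e(1) by (intro exI[of _ "min d e"]) auto
qed

section \<open>Groups with one defining relator\<close>

lemma normal_normal_closure:
  assumes "group G" "R \<subseteq> carrier G"
  shows "normal_closure G R \<lhd> G"
proof -
  interpret group G by fact
  have sub: "subgroup (normal_closure G R) G"
    unfolding normal_closure_def
  proof (rule subgroups_Inter)
    show "{N. N \<lhd> G \<and> R \<subseteq> N} \<noteq> {}"
      using normal_inv_iff[of "carrier G"] subgroup_self assms(2) by blast
    show "\<And>N. N \<in> {N. N \<lhd> G \<and> R \<subseteq> N} \<Longrightarrow> subgroup N G"
      using normal_imp_subgroup by blast
  qed
  have "x \<otimes>\<^bsub>G\<^esub> h \<otimes>\<^bsub>G\<^esub> inv\<^bsub>G\<^esub> x \<in> normal_closure G R"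
    if "x \<in> carrier G" "h \<in> normal_closure G R" for x h
    using that unfolding normal_closure_def normal_inv_iff by blast
  with sub show ?thesis by (simp add: normal_inv_iff)
qed

lemma presentation_hom:
  assumes "has_presentation G X {r}"
  obtains \<theta> where "\<theta> ` carrier (free_group X) = carrier G"
    "\<And>u w. u \<in> carrier (free_group X) \<Longrightarrow> w \<in> carrier (free_group X) \<Longrightarrow>
      \<theta> (reduce (u @ w)) = \<theta> u \<otimes>\<^bsub>G\<^esub> \<theta> w"
    "\<And>w. w \<in> carrier (free_group X) \<Longrightarrow> \<theta> w = \<theta> [] \<longleftrightarrow> w \<in> normal_closure (free_group X) {r}"
proof -
  let ?F = "free_group X" and ?N = "normal_closure (free_group X) {r}"
  interpret F: group ?F by (rule group_free_group)
  have r: "{r} \<subseteq> carrier ?F" and iso: "?F Mod ?N \<cong> G" using assms by (auto simp: has_presentation_def)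
  interpret N: normal ?N ?F by (rule normal_normal_closure[OF F.is_group r])
  obtain \<iota> where \<iota>: "\<iota> \<in> iso (?F Mod ?N) G" using iso by (auto simp: is_iso_def)
  then have hom: "\<And>A B. A \<in> rcosets\<^bsub>?F\<^esub> ?N \<Longrightarrow> B \<in> rcosets\<^bsub>?F\<^esub> ?N \<Longrightarrow> \<iota> (A <#>\<^bsub>?F\<^esub> B) = \<iota> A \<otimes>\<^bsub>G\<^esub> \<iota> B"
    and bij: "bij_betw \<iota> (rcosets\<^bsub>?F\<^esub> ?N) (carrier G)"
    by (auto simp: iso_def hom_def FactGroup_def)
  define \<theta> where "\<theta> w = \<iota> (?N #>\<^bsub>?F\<^esub> w)" for w
  have cos: "?N #>\<^bsub>?F\<^esub> w \<in> rcosets\<^bsub>?F\<^esub> ?N" if "w \<in> carrier ?F" for w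
    using that by (auto simp: RCOSETS_def)
  have one: "[] \<in> carrier ?F" by (simp add: carrier_free_group)
  have N1: "?N #>\<^bsub>?F\<^esub> [] = ?N" using F.coset_mult_one[OF N.subset] by simp
  show thesis
  proof (rule that[of \<theta>])
    have "\<theta> ` carrier ?F = \<iota> ` (rcosets\<^bsub>?F\<^esub> ?N)" by (auto simp: \<theta>_def RCOSETS_def)
    then show "\<theta> ` carrier ?F = carrier G" using bij by (simp add: bij_betw_def)
    show "\<theta> (reduce (u @ w)) = \<theta> u \<otimes>\<^bsub>G\<^esub> \<theta> w" if "u \<in> carrier ?F" "w \<in> carrier ?F" for u w
      using N.rcos_sum[OF that] hom[OF cos cos, OF that] by (simp add: \<theta>_def)
    show "\<theta> w = \<theta> [] \<longleftrightarrow> w \<in> ?N" if w: "w \<in> carrier ?F" for w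
    proof -
      have "\<theta> w = \<theta> [] \<longleftrightarrow> ?N #>\<^bsub>?F\<^esub> w = ?N #>\<^bsub>?F\<^esub> []"
        unfolding \<theta>_def using inj_on_eq_iff[OF bij_betw_imp_inj_on[OF bij] cos[OF w] cos[OF one]] .
      also have "\<dots> \<longleftrightarrow> w \<in> ?N"
        using F.coset_join1[OF _ w N.subgroup_axioms] F.coset_join2[OF w N.subgroup_axioms] N1 by auto
      finally show ?thesis .
    qed
  qed
qed

text \<open>
  The presentation and the embedding combine to a homomorphism \<open>\<eta>\<close> from the free group to the
  increasing bijections of the line whose kernel is the normal closure of \<open>r\<close>; it is evaluation of
  words at the images \<open>v x\<close> of the generators. The subgroup \<open>H\<close> enters as a set only, which covers
  subgroups of Thompson's group without a separate argument.
\<close>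

theorem one_relator_not_PL0:
  assumes G: "group G" "has_presentation G X {r}" "\<not> comm_group G"
    and H: "H \<subseteq> carrier PL0" and iso: "G \<cong> PL0\<lparr>carrier := H\<rparr>"
  shows False
proof -
  let ?F = "free_group X"
  interpret F: group ?F by (rule group_free_group)
  interpret G: group G by fact
  obtain \<theta> where \<theta>: "\<theta> ` carrier ?F = carrier G"
    "\<And>u w. u \<in> carrier ?F \<Longrightarrow> w \<in> carrier ?F \<Longrightarrow> \<theta> (reduce (u @ w)) = \<theta> u \<otimes>\<^bsub>G\<^esub> \<theta> w"
    "\<And>w. w \<in> carrier ?F \<Longrightarrow> \<theta> w = \<theta> [] \<longleftrightarrow> w \<in> normal_closure ?F {r}"
    using presentation_hom[OF G(2)] by blast
  obtain \<iota> where \<iota>: "\<And>x y. x \<in> carrier G \<Longrightarrow> y \<in> carrier G \<Longrightarrow> \<iota> (x \<otimes>\<^bsub>G\<^esub> y) = \<iota> x \<otimes>\<^bsub>PL0\<^esub> \<iota> y"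
    and \<iota>_inj: "inj_on \<iota> (carrier G)" and \<iota>_im: "\<iota> ` carrier G = H"
    using iso by (auto simp: is_iso_def iso_def hom_def bij_betw_def)
  have \<iota>_PL0: "\<iota> x \<in> carrier PL0" if "x \<in> carrier G" for x using that \<iota>_im H by blast
  have \<theta>G: "\<theta> w \<in> carrier G" if "w \<in> carrier ?F" for w using that \<theta>(1) by blast
  define \<eta> where "\<eta> w = extend (\<iota> (\<theta> w))" for w
  have extend_\<iota>: "extend (\<iota> (x \<otimes>\<^bsub>G\<^esub> y)) = extend (\<iota> x) + extend (\<iota> y)"
    if "x \<in> carrier G" "y \<in> carrier G" for x y
    using extend_mult[of "\<iota> x" "\<iota> y"] \<iota>[OF that] \<iota>_PL0 that by (metis G.m_closed)
  have extend_\<iota>_inject: "extend (\<iota> x) = extend (\<iota> y) \<Longrightarrow> x = y"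
    if "x \<in> carrier G" "y \<in> carrier G" for x y
    using extend_inject \<iota>_PL0 \<iota>_inj that by (metis inj_onD)
  have \<eta>_mult: "\<eta> (reduce (u @ w)) = \<eta> u + \<eta> w" if "u \<in> carrier ?F" "w \<in> carrier ?F" for u w
    unfolding \<eta>_def using \<theta>(2)[OF that] extend_\<iota> \<theta>G that by simp
  have one: "[] \<in> carrier ?F" by (simp add: carrier_free_group)
  have \<eta>_Nil: "\<eta> [] = 0"
  proof -
    have "\<eta> [] = \<eta> [] + \<eta> []" using \<eta>_mult[OF one one] by (simp add: reduce_def)
    then show ?thesis by (metis add_0_right add_left_cancel)
  qed
  have \<eta>_eq_0: "\<eta> w = 0 \<longleftrightarrow> w \<in> normal_closure ?F {r}" if "w \<in> carrier ?F" for w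
  proof -
    have "\<eta> w = 0 \<longleftrightarrow> \<theta> w = \<theta> []"
      using extend_\<iota>_inject[OF \<theta>G[OF that] \<theta>G[OF one]] \<eta>_Nil unfolding \<eta>_def by auto
    then show ?thesis using \<theta>(3)[OF that] by simp
  qed
  have \<eta>_inv: "\<eta> (reduce (inv_word w)) = - \<eta> w" if "w \<in> carrier ?F" for w
  proof -
    have "\<eta> (reduce (inv_word w)) + \<eta> w = 0"
      using \<eta>_mult[OF inv_word_carrier[OF that] that] by (simp add: reduce_append_reduce reduce_inverse \<eta>_Nil)
    then show ?thesis by (simp add: eq_neg_iff_add_eq_0)
  qed
  define v where "v x = \<eta> [(x, True)]" for x
  have letter: "\<eta> [p] = letter_val v p" if "fst p \<in> X" for p
  proof (cases p)
    case (Pair x s)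
    have x: "[(x, True)] \<in> carrier ?F" using that Pair by (auto simp: carrier_free_group)
    show ?thesis
      using \<eta>_inv[OF x] Pair by (cases s) (simp_all add: v_def letter_inv_def reduce_def)
  qed
  have val: "word_val v w = \<eta> w" if "w \<in> carrier ?F" for w
    using that
  proof (induction w)
    case (Cons p w)
    then have pw: "[p] \<in> carrier ?F" "w \<in> carrier ?F" and red: "reduced (p # w)" and p: "fst p \<in> X"
      using reduced_tl[of p w] by (auto simp: carrier_free_group)
    show ?case using \<eta>_mult[OF pw] letter[OF p] Cons.IH[OF pw(2)] reduce_reduced[OF red] by simp
  qed (simp add: \<eta>_Nil)
  define K where "K = \<eta> ` carrier ?F"
  have K: "is_subgroup K"
    unfolding is_subgroup_def
  proof (intro conjI ballI)
    show "0 \<in> K" using one \<eta>_Nil unfolding K_def by force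
    fix x y assume "x \<in> K" "y \<in> K"
    then obtain u w where uw: "u \<in> carrier ?F" "x = \<eta> u" "w \<in> carrier ?F" "y = \<eta> w"
      unfolding K_def by blast
    have "x - y = \<eta> (reduce (u @ reduce (inv_word w)))"
      using \<eta>_mult[OF uw(1) inv_word_carrier[OF uw(3)]] \<eta>_inv[OF uw(3)] uw by simp
    moreover have "reduce (u @ reduce (inv_word w)) \<in> carrier ?F"
      using F.m_closed[OF uw(1) inv_word_carrier[OF uw(3)]] by simp
    ultimately show "x - y \<in> K" unfolding K_def by blast
  qed
  have K_eq: "K = (\<lambda>x. extend (\<iota> x)) ` carrier G" unfolding K_def \<eta>_def \<theta>(1)[symmetric] by auto
  obtain x y where xy: "x \<in> carrier G" "y \<in> carrier G" "x \<otimes>\<^bsub>G\<^esub> y \<noteq> y \<otimes>\<^bsub>G\<^esub> x"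
    using G(3) G.group_comm_groupI by blast
  let ?f = "extend (\<iota> x)" and ?g = "extend (\<iota> y)"
  have fg: "?f \<in> K" "?g \<in> K" using xy(1,2) K_eq by blast+
  have noncomm: "?f + ?g \<noteq> ?g + ?f"
    using xy(3) extend_\<iota>_inject[OF G.m_closed[OF xy(1,2)] G.m_closed[OF xy(2,1)]]
    unfolding extend_\<iota>[OF xy(1,2)] extend_\<iota>[OF xy(2,1)] by blast
  have bounded: "\<And>x. x \<le> 0 \<or> 1 \<le> x \<Longrightarrow> app ?f x = x \<and> app ?g x = x"
    using app_extend_outside[OF \<iota>_PL0] xy(1,2) by blast
  have germs: "\<And>p. app ?f p = p \<Longrightarrow> app ?g p = p \<Longrightarrow>
      \<exists>\<delta>>0. \<forall>x. \<bar>x - p\<bar> < \<delta> \<longrightarrow> app ?f (app ?g x) = app ?g (app ?f x)"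
    using commute_near_common_fixed_point[OF \<iota>_PL0[OF xy(1)] _ \<iota>_PL0[OF xy(2)]] .
  obtain a b c y1 z1 where abc: "a \<in> K" "b \<in> K" "c \<in> K"
    "a + b = b + a" "b + c = c + b" "c + a = a + c" "a \<noteq> 0"
    "app a y1 = y1" "app b y1 \<noteq> y1" "app a z1 = z1" "app b z1 = z1" "app c z1 \<noteq> z1"
    by (rule commuting_triple[OF K fg noncomm bounded germs])
  obtain u w z where uwz: "u \<in> carrier ?F" "\<eta> u = a" "w \<in> carrier ?F" "\<eta> w = b" "z \<in> carrier ?F" "\<eta> z = c"
    using abc(1-3) unfolding K_def by blast
  have r: "r \<in> carrier ?F" using G(2) by (simp add: has_presentation_def)
  have "r \<in> normal_closure ?F {r}" by (auto simp: normal_closure_def)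
  then have r0: "word_val v r = 0" using val[OF r] \<eta>_eq_0[OF r] by simp
  show False
  proof (rule one_relator_no_commuting_triple[OF unique_products_line_aut r r0 _ uwz(1) _ uwz(3) _ uwz(5) _ abc(4-7)
        is_subgroup_stabilizer[of y1] _ _ is_subgroup_stabilizer[of z1]])
    show "\<And>w. w \<in> carrier ?F \<Longrightarrow> word_val v w = 0 \<Longrightarrow> w \<in> normal_closure ?F {r}"
      using val \<eta>_eq_0 by simp
    show "word_val v u = a" "word_val v w = b" "word_val v z = c" using val uwz by simp_all
    show "npow n b \<notin> {h. app h y1 = y1}" if "n > 0" for n using npow_moves[OF abc(9) that] by simp
    show "npow n c \<notin> {h. app h z1 = z1}" if "n > 0" for n using npow_moves[OF abc(12) that] by simp
    show "a \<in> {h. app h y1 = y1}" "a \<in> {h. app h z1 = z1}" "b \<in> {h. app h z1 = z1}"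
      using abc(8,10,11) by simp_all
  qed
qed

theorem corollary23:
  fixes G :: "('g, 'b) monoid_scheme" and X :: "'a set" and r :: "'a word"
  assumes "group G"
    and "has_presentation G X {r}"
    and "\<not> comm_group G"
  shows "\<not> (\<exists>H. subgroup H PL0 \<and> G \<cong> PL0\<lparr>carrier := H\<rparr>) \<and>
         \<not> (\<exists>H. subgroup H Thompson_F \<and> G \<cong> Thompson_F\<lparr>carrier := H\<rparr>)"
proof (intro conjI notI; elim exE conjE)
  fix H assume "subgroup H PL0" "G \<cong> PL0\<lparr>carrier := H\<rparr>"
  then show False using one_relator_not_PL0[OF assms] subgroup.subset by blast
next
  fix H assume H: "subgroup H Thompson_F" "G \<cong> Thompson_F\<lparr>carrier := H\<rparr>"
  have "H \<subseteq> carrier PL0" using subgroup.subset[OF H(1)] by (auto simp: Thompson_F_def)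
  moreover have "Thompson_F\<lparr>carrier := H\<rparr> = PL0\<lparr>carrier := H\<rparr>" by (simp add: Thompson_F_def)
  ultimately show False using one_relator_not_PL0[OF assms] H(2) by simp
qed

end
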